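(* For every integer $q\ge 2$ there exists a constant $D_1(q)$, depending only on $q$, with $D_1(q)=O(\sqrt q\,\log q)$, such that for every $d,N\in\mathbb N$ and every function $$f=\sum_{\substack{\bm m\in\{0,\ldots,q-1\}^N\\ |\operatorname{supp}(\bm m)|\le d}}\widehat f(\bm m)\,\chi_{\bm m}\in\mathcal B_{\le d}(C_q^N)$$ one has $$\Bigg(\sum_{\substack{\bm m\in\{0,\ldots,q-1\}^N\\ |\operatorname{supp}(\bm m)|\le d}}|\widehat f(\bm m)|^{\frac{2d}{d+1}}\Bigg)^{\frac{d+1}{2d}}\le D_1(q)^d\,\|f\|_{L_\infty(C_q^N)}.$$ Moreover, the exponent $\frac{2d}{d+1}$ is optimal: for fixed $q$ and $d$ it cannot be replaced by any $0<p<\frac{2d}{d+1}$ with a constant independent of $N$; i.e., for no such $p$ is there a constant $C$ (depending on $q,d,p$ but not on $N$) with $\big(\sum_{|\operatorname{supp}(\bm m)|\le d}|\widehat f(\bm m)|^{p}\big)^{1/p}\le C\|f\|_{L_\infty(C_q^N)}$ for all $N$ and all $f\in\mathcal B_{\le d}(C_q^N)$.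
   Context: $\mathbb N=\{1,2,\ldots\}$. $C_q=\{\omega^0,\ldots,\omega^{q-1}\}\subset\mathbb C$, $\omega=e^{2\pi i/q}$, is the multiplicative group of $q$-th roots of unity, and $C_q^N$ is its $N$-fold product. $\mathbb Z_q^N$ is identified with $\{0,\ldots,q-1\}^N$. For $\bm m=(m_1,\ldots,m_N)\in\{0,\ldots,q-1\}^N$, $\chi_{\bm m}(x)=x_1^{m_1}\cdots x_N^{m_N}$ for $x\in C_q^N$, and $\operatorname{supp}(\bm m)=\{j: m_j\ne 0\}$. Every $f:C_q^N\to\mathbb C$ has a unique expansion $f=\sum_{\bm m}\widehat f(\bm m)\chi_{\bm m}$, with $\widehat f(\bm m)=q^{-N}\sum_{x\in C_q^N}f(x)\overline{\chi_{\bm m}(x)}$. $\mathcal B_{\le d}(C_q^N)=\operatorname{span}\{\chi_{\bm m}:|\operatorname{supp}(\bm m)|\le d\}$ (complex span). $\|f\|_{L_\infty(C_q^N)}=\max_{x\in C_q^N}|f(x)|$. $D_1(q)=O(\sqrt q\log q)$ means that there is an absolute constant $A$ with $D_1(q)\le A\sqrt q\log q$ for all $q\ge2$. *)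

theory Defs
  imports "HOL-Analysis.Analysis"
begin

text \<open>
  Points of $C_q^N$ and multi-indices in $\{0,\ldots,q-1\}^N$ are extensional functions on
  the coordinate set \<open>{..<N}\<close> (coordinates are numbered from 0), so that \<open>N\<close> can be
  quantified over inside a formula. A function on $C_q^N$ is represented by any function on
  the ambient type; only its values on \<open>cyc_cube q N\<close> are ever used.
\<close>

definition root_of_unity_gen :: "nat \<Rightarrow> complex" where
  "root_of_unity_gen q = exp (2 * of_real pi * \<i> / of_nat q)"

definition cyc_group :: "nat \<Rightarrow> complex set" where
  "cyc_group q = {root_of_unity_gen q ^ k | k. k < q}"

definition cyc_cube :: "nat \<Rightarrow> nat \<Rightarrow> (nat \<Rightarrow> complex) set" where
  "cyc_cube q N = {..<N} \<rightarrow>\<^sub>E cyc_group q"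

definition multi_indices :: "nat \<Rightarrow> nat \<Rightarrow> (nat \<Rightarrow> nat) set" where
  "multi_indices q N = {..<N} \<rightarrow>\<^sub>E {..<q}"

definition character :: "nat \<Rightarrow> (nat \<Rightarrow> nat) \<Rightarrow> (nat \<Rightarrow> complex) \<Rightarrow> complex" where
  "character N m x = (\<Prod>j<N. x j ^ m j)"

definition index_supp :: "nat \<Rightarrow> (nat \<Rightarrow> nat) \<Rightarrow> nat set" where
  "index_supp N m = {j. j < N \<and> m j \<noteq> 0}"

definition low_indices :: "nat \<Rightarrow> nat \<Rightarrow> nat \<Rightarrow> (nat \<Rightarrow> nat) set" where
  "low_indices q N d = {m \<in> multi_indices q N. card (index_supp N m) \<le> d}"

definition fourier_coeff ::
    "nat \<Rightarrow> nat \<Rightarrow> ((nat \<Rightarrow> complex) \<Rightarrow> complex) \<Rightarrow> (nat \<Rightarrow> nat) \<Rightarrow> complex" where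
  "fourier_coeff q N f m =
     (\<Sum>x\<in>cyc_cube q N. f x * cnj (character N m x)) / of_nat q ^ N"

text \<open>
  The complex linear span of the characters with at most \<open>d\<close> active coordinates, as
  functions on $C_q^N$. The index set is finite, so the span consists of the linear
  combinations of the whole family.
\<close>

definition low_degree :: "nat \<Rightarrow> nat \<Rightarrow> nat \<Rightarrow> ((nat \<Rightarrow> complex) \<Rightarrow> complex) set" where
  "low_degree q N d =
     {f. \<exists>a :: (nat \<Rightarrow> nat) \<Rightarrow> complex.
           \<forall>x\<in>cyc_cube q N. f x = (\<Sum>m\<in>low_indices q N d. a m * character N m x)}"

definition sup_norm :: "nat \<Rightarrow> nat \<Rightarrow> ((nat \<Rightarrow> complex) \<Rightarrow> complex) \<Rightarrow> real" where
  "sup_norm q N f = Max ((\<lambda>x. cmod (f x)) ` cyc_cube q N)"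

end

theory Submission
  imports Defs
begin

text \<open>
  For the inequality, let \<open>w\<^sub>j\<close> be the \<open>\<ell>\<^sup>2\<close> norm of the coefficients whose support contains \<open>j\<close>, that is,
  the \<open>L\<^sup>2\<close> norm of the part of \<open>f\<close> depending on \<open>x\<^sub>j\<close>. A form of Blei's inequality bounds the
  \<open>2d/(d+1)\<close>-norm of the nonconstant coefficients by a constant times \<open>\<surd>q \<Sum>\<^sub>j w\<^sub>j\<close>. Hypercontractivity
  in the remaining \<open>N - 1\<close> variables, in which the degree has dropped to \<open>d - 1\<close>, replaces \<open>L\<^sup>2\<close> by
  \<open>L\<^sup>1\<close> at the cost of \<open>(4\<surd>q)\<close> to the power \<open>d - 1\<close>. It remains to bound
  \<open>\<Sum>\<^sub>j \<bar>f(x with x\<^sub>j replaced by y\<^sub>j) - f(x)\<bar>\<close> for fixed \<open>x\<close> and \<open>y\<close>. If each coordinate in a set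
  \<open>J\<close> is moved from \<open>x\<close> to \<open>y\<close> with probability \<open>t\<close>, the expectation of \<open>f\<close> is a polynomial of
  degree at most \<open>d\<close> in \<open>t\<close> which is bounded on \<open>[0, 1]\<close> by the sup norm of \<open>f\<close>, hence so is its derivative
  at \<open>0\<close> up to a factor exponential in \<open>d\<close>; this derivative is the sum of the differences over \<open>J\<close>.

  For the optimality, chaining \<open>n \<times> n\<close> discrete Fourier matrices gives a \<open>d\<close>-linear form in \<open>d\<close>
  blocks of \<open>n\<close> variables with \<open>n\<close> to the \<open>d\<close> unimodular coefficients and sup norm at most \<open>n\<close> to the
  \<open>(d+1)/2\<close>.
\<close>

section \<open>Characters of the cyclic cube\<close>

lemma cyc_group_eq:
  assumes "q > 0"
  shows "cyc_group q = {z. z ^ q = 1}"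
proof -
  have "root_of_unity_gen q ^ k = exp (2 * of_real pi * \<i> * of_nat k / of_nat q)" for k
    by (simp add: root_of_unity_gen_def exp_of_nat_mult[symmetric] field_simps)
  then show ?thesis
    using assms complex_roots_unity[of q] by (simp add: cyc_group_def)
qed

lemma card_cyc_group: "q > 0 \<Longrightarrow> card (cyc_group q) = q"
  using card_complex_roots_unity[of q] by (simp add: cyc_group_eq)

lemma finite_cyc_group [simp]: "finite (cyc_group q)"
  by (auto simp: cyc_group_def)

lemma norm_cyc_group: "q > 0 \<Longrightarrow> z \<in> cyc_group q \<Longrightarrow> cmod z = 1"
  by (auto simp: cyc_group_eq dest: power_eq_1_iff)

lemma one_in_cyc_group: "q > 0 \<Longrightarrow> 1 \<in> cyc_group q"
  by (simp add: cyc_group_eq)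

lemma mult_cyc_group: "q > 0 \<Longrightarrow> y \<in> cyc_group q \<Longrightarrow> z \<in> cyc_group q \<Longrightarrow> y * z \<in> cyc_group q"
  by (simp add: cyc_group_eq power_mult_distrib)

lemma bij_betw_mult_cyc_group:
  assumes "q > 0" "y \<in> cyc_group q"
  shows "bij_betw ((*) y) (cyc_group q) (cyc_group q)"
proof -
  have "inj_on ((*) y) (cyc_group q)"
    using norm_cyc_group[OF assms] by (auto simp: inj_on_def)
  moreover have "(*) y ` cyc_group q \<subseteq> cyc_group q"
    using assms mult_cyc_group by auto
  ultimately show ?thesis
    by (metis bij_betw_def endo_inj_surj finite_cyc_group)
qed

lemma sum_cyc_group_mult:
  assumes "q > 0" "y \<in> cyc_group q"
  shows "(\<Sum>z\<in>cyc_group q. g (y * z)) = (\<Sum>z\<in>cyc_group q. g z)"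
  using sum.reindex_bij_betw[OF bij_betw_mult_cyc_group[OF assms]] .

text \<open>The equation \<open>z ^ b = 1\<close> has only \<open>b\<close> solutions, too few to
  contain all \<open>q\<close> elements of the group.\<close>

lemma ex_cyc_group_power_neq_1:
  assumes "0 < b" "b < q"
  shows "\<exists>y\<in>cyc_group q. y ^ b \<noteq> 1"
proof (rule ccontr)
  assume "\<not> ?thesis"
  then have "cyc_group q \<subseteq> {z. z ^ b = 1}" by auto
  then have "card (cyc_group q) \<le> card {z::complex. z ^ b = 1}"
    using assms finite_roots_unity[of b] by (intro card_mono) auto
  then show False
    using assms card_complex_roots_unity[of b] by (simp add: card_cyc_group)
qed

text \<open>The sum is invariant under multiplication of the group by \<open>y\<close>, which also
  multiplies it by \<open>y ^ b\<close>; some \<open>y\<close> makes this factor different from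
  1.\<close>

lemma sum_power_cyc_group:
  assumes "0 < b" "b < q"
  shows "(\<Sum>z\<in>cyc_group q. z ^ b) = 0"
proof -
  obtain y where y: "y \<in> cyc_group q" "y ^ b \<noteq> 1"
    using ex_cyc_group_power_neq_1[OF assms] by blast
  have "(\<Sum>z\<in>cyc_group q. z ^ b) = (\<Sum>z\<in>cyc_group q. (y * z) ^ b)"
    using sum_cyc_group_mult[of q y "\<lambda>z. z ^ b"] assms y by simp
  also have "\<dots> = y ^ b * (\<Sum>z\<in>cyc_group q. z ^ b)"
    by (simp add: power_mult_distrib sum_distrib_left)
  finally show ?thesis
    using y by simp
qed

lemma sum_power_cnj_cyc_group:
  assumes "b < q" "c < q"
  shows "(\<Sum>z\<in>cyc_group q. z ^ b * cnj (z ^ c)) = (if b = c then of_nat q else 0)"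
proof -
  have q: "q > 0" using assms by simp
  have inv: "z * cnj z = 1" if "z \<in> cyc_group q" for z
    using norm_cyc_group[OF q that] by (simp add: complex_norm_square[symmetric])
  consider "b = c" | "b < c" | "c < b" by linarith
  then show ?thesis
  proof cases
    case 1
    have "z ^ b * cnj (z ^ c) = 1" if "z \<in> cyc_group q" for z
      using inv[OF that] 1 by (simp flip: power_mult_distrib)
    then show ?thesis using 1 q by (simp add: card_cyc_group)
  next
    case 2
    have "z ^ b * cnj (z ^ c) = cnj (z ^ (c - b))" if "z \<in> cyc_group q" for z
    proof -
      have "z ^ b * cnj (z ^ c) = (z * cnj z) ^ b * cnj z ^ (c - b)"
        using 2 by (simp add: power_mult_distrib flip: power_add)
      then show ?thesis by (simp add: inv[OF that])
    qed
    then have "(\<Sum>z\<in>cyc_group q. z ^ b * cnj (z ^ c)) = cnj (\<Sum>z\<in>cyc_group q. z ^ (c - b))"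
      by simp
    then show ?thesis using 2 assms sum_power_cyc_group[of "c - b" q] by simp
  next
    case 3
    have "z ^ b * cnj (z ^ c) = z ^ (b - c)" if "z \<in> cyc_group q" for z
    proof -
      have "z ^ b * cnj (z ^ c) = (z * cnj z) ^ c * z ^ (b - c)"
        using 3 by (simp add: power_mult_distrib flip: power_add)
      then show ?thesis by (simp add: inv[OF that])
    qed
    then show ?thesis using 3 assms sum_power_cyc_group[of "b - c" q] by simp
  qed
qed

section \<open>Points and multi-indices of the cube, orthogonality of the characters\<close>

lemma finite_cyc_cube [simp]: "finite (cyc_cube q N)"
  by (simp add: cyc_cube_def finite_PiE)

lemma finite_multi_indices [simp]: "finite (multi_indices q N)"
  by (simp add: multi_indices_def finite_PiE)

lemma finite_low_indices [simp]: "finite (low_indices q N d)"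
  by (simp add: low_indices_def)

lemma cyc_cube_nonempty: "q > 0 \<Longrightarrow> cyc_cube q N \<noteq> {}"
  using one_in_cyc_group by (auto simp: cyc_cube_def PiE_eq_empty_iff)

lemma card_cyc_cube: "q > 0 \<Longrightarrow> card (cyc_cube q N) = q ^ N"
  by (simp add: cyc_cube_def card_PiE card_cyc_group)

lemma cyc_cube_upd: "x \<in> cyc_cube q N \<Longrightarrow> j < N \<Longrightarrow> y \<in> cyc_group q \<Longrightarrow> x(j := y) \<in> cyc_cube q N"
  unfolding cyc_cube_def by (auto simp: PiE_def Pi_def extensional_def)

lemma cyc_cube_nth: "x \<in> cyc_cube q N \<Longrightarrow> j < N \<Longrightarrow> x j \<in> cyc_group q"
  unfolding cyc_cube_def by auto

lemma sum_PiE_Suc: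
  fixes N :: nat
  shows "(\<Sum>x\<in>{..<Suc N} \<rightarrow>\<^sub>E A. g x) = (\<Sum>y\<in>A. \<Sum>x\<in>{..<N} \<rightarrow>\<^sub>E A. g (x(N := y)))"
proof -
  have "(\<Sum>x\<in>{..<Suc N} \<rightarrow>\<^sub>E A. g x) = (\<Sum>(y, x)\<in>A \<times> ({..<N} \<rightarrow>\<^sub>E A). g (x(N := y)))"
    unfolding lessThan_Suc PiE_insert_eq
    using inj_combinator[of N "{..<N}" "\<lambda>_. A"]
    by (subst sum.reindex) (auto simp: case_prod_unfold)
  then show ?thesis by (simp add: sum.cartesian_product)
qed

lemma character_orthogonal:
  assumes "m \<in> multi_indices q N" "n \<in> multi_indices q N"
  shows "(\<Sum>x\<in>cyc_cube q N. character N m x * cnj (character N n x)) =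
    (if m = n then of_nat q ^ N else 0)"
proof -
  have lt: "m j < q" "n j < q" if "j < N" for j
    using assms that by (auto simp: multi_indices_def)
  have "(\<Sum>x\<in>cyc_cube q N. character N m x * cnj (character N n x)) =
      (\<Prod>j<N. \<Sum>z\<in>cyc_group q. z ^ m j * cnj (z ^ n j))"
    unfolding cyc_cube_def
    by (subst prod_sum_PiE) (auto simp: character_def prod.distrib)
  also have "\<dots> = (\<Prod>j<N. if m j = n j then of_nat q else 0)"
    using lt by (intro prod.cong refl sum_power_cnj_cyc_group) auto
  also have "\<dots> = (if m = n then of_nat q ^ N else 0)"
  proof (cases "m = n")
    case False
    then obtain j where "j < N" "m j \<noteq> n j"
      using assms unfolding multi_indices_def by (metis PiE_ext lessThan_iff)
    then have "(\<Prod>j<N. if m j = n j then of_nat q else 0) = (0::complex)"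
      by (intro prod_zero) auto
    with False show ?thesis by simp
  qed simp
  finally show ?thesis .
qed

section \<open>Hypercontractivity\<close>

text \<open>The sum runs over all multi-indices; the degree is a separate condition
  \<open>deg_le\<close> on the coefficients, so that the index set stays the same when the degree
  drops.\<close>

definition char_sum :: "nat \<Rightarrow> nat \<Rightarrow> ((nat \<Rightarrow> nat) \<Rightarrow> complex) \<Rightarrow> (nat \<Rightarrow> complex) \<Rightarrow> complex" where
  "char_sum q N a x = (\<Sum>m\<in>multi_indices q N. a m * character N m x)"

definition cube_avg :: "nat \<Rightarrow> nat \<Rightarrow> ((nat \<Rightarrow> complex) \<Rightarrow> real) \<Rightarrow> real" where
  "cube_avg q N g = (\<Sum>x\<in>cyc_cube q N. g x) / real q ^ N"

definition deg_le :: "nat \<Rightarrow> nat \<Rightarrow> nat \<Rightarrow> ((nat \<Rightarrow> nat) \<Rightarrow> complex) \<Rightarrow> bool" where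
  "deg_le q N d a \<longleftrightarrow> (\<forall>m\<in>multi_indices q N. a m \<noteq> 0 \<longrightarrow> card (index_supp N m) \<le> d)"

section \<open>Averages over the cube\<close>

lemma cube_avg_mono:
  "(\<And>x. x \<in> cyc_cube q N \<Longrightarrow> f x \<le> g x) \<Longrightarrow> cube_avg q N f \<le> cube_avg q N g"
  unfolding cube_avg_def by (intro divide_right_mono sum_mono) auto

lemma cube_avg_nonneg:
  "(\<And>x. x \<in> cyc_cube q N \<Longrightarrow> 0 \<le> f x) \<Longrightarrow> 0 \<le> cube_avg q N f"
  unfolding cube_avg_def by (intro divide_nonneg_nonneg sum_nonneg) auto

lemma cube_avg_add: "cube_avg q N (\<lambda>x. f x + g x) = cube_avg q N f + cube_avg q N g"
  unfolding cube_avg_def by (simp add: sum.distrib add_divide_distrib)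

lemma cube_avg_cmult: "cube_avg q N (\<lambda>x. c * f x) = c * cube_avg q N f"
  unfolding cube_avg_def by (simp add: sum_distrib_left)

lemma cube_avg_sum: "cube_avg q N (\<lambda>x. \<Sum>i\<in>I. f i x) = (\<Sum>i\<in>I. cube_avg q N (f i))"
  unfolding cube_avg_def by (simp add: sum_divide_distrib[symmetric] sum.swap[of _ I])

lemma cube_avg_const: "q > 0 \<Longrightarrow> cube_avg q N (\<lambda>x. c) = c"
  unfolding cube_avg_def by (simp add: card_cyc_cube)

lemma cube_avg_Cauchy_Schwarz:
  "(cube_avg q N (\<lambda>x. f x * g x))\<^sup>2 \<le> cube_avg q N (\<lambda>x. (f x)\<^sup>2) * cube_avg q N (\<lambda>x. (g x)\<^sup>2)"
  unfolding cube_avg_def power_divide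
  using Cauchy_Schwarz_ineq_sum[of f g "cyc_cube q N"]
  by (simp add: power2_eq_square divide_right_mono)

lemma cube_avg_Suc:
  "cube_avg q (Suc N) g = (\<Sum>y\<in>cyc_group q. cube_avg q N (\<lambda>x. g (x(N := y)))) / real q"
  unfolding cube_avg_def cyc_cube_def sum_PiE_Suc
  by (simp add: sum_divide_distrib[symmetric] mult.commute)

section \<open>Splitting off the last variable\<close>

lemma character_upd:
  "character (Suc N) (m(N := b)) (x(N := y)) = y ^ b * character N m x"
  unfolding character_def by simp

lemma index_supp_upd:
  "index_supp (Suc N) (m(N := b)) = (if b = 0 then index_supp N m else insert N (index_supp N m))"
  unfolding index_supp_def by (auto simp: less_Suc_eq)

lemma finite_index_supp [simp]: "finite (index_supp N m)"
  by (simp add: index_supp_def)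

lemma multi_indices_upd:
  "m \<in> multi_indices q N \<Longrightarrow> b < q \<Longrightarrow> m(N := b) \<in> multi_indices q (Suc N)"
  unfolding multi_indices_def lessThan_Suc by (metis PiE_fun_upd lessThan_iff)

text \<open>The indices with last entry 0 give the part free of \<open>y\<close>. In the rest the
  powers of \<open>y\<close> are absorbed into the coefficients, so that for fixed \<open>y\<close>
  both parts are character sums in \<open>N\<close> variables, open to induction.\<close>

lemma char_sum_Suc:
  assumes "q > 0"
  shows "char_sum q (Suc N) a (x(N := y)) = char_sum q N (\<lambda>m. a (m(N := 0))) x +
    char_sum q N (\<lambda>m. \<Sum>b\<in>{1..<q}. a (m(N := b)) * y ^ b) x"
proof -
  have split: "{..<q} = insert 0 {1..<q}"
    using assms by auto
  have "char_sum q (Suc N) a (x(N := y)) =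
      (\<Sum>b<q. \<Sum>m\<in>multi_indices q N. a (m(N := b)) * (y ^ b * character N m x))"
    unfolding char_sum_def multi_indices_def sum_PiE_Suc character_upd ..
  also have "\<dots> = char_sum q N (\<lambda>m. a (m(N := 0))) x +
      (\<Sum>b\<in>{1..<q}. \<Sum>m\<in>multi_indices q N. a (m(N := b)) * (y ^ b * character N m x))"
    unfolding split by (simp add: char_sum_def)
  also have "(\<Sum>b\<in>{1..<q}. \<Sum>m\<in>multi_indices q N. a (m(N := b)) * (y ^ b * character N m x)) =
      char_sum q N (\<lambda>m. \<Sum>b\<in>{1..<q}. a (m(N := b)) * y ^ b) x"
    unfolding char_sum_def by (subst sum.swap) (simp add: sum_distrib_right mult.assoc)
  finally show ?thesis .
qed

lemma sum_char_sum_Suc_eq_0: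
  "(\<Sum>y\<in>cyc_group q. char_sum q N (\<lambda>m. \<Sum>b\<in>{1..<q}. a (m(N := b)) * y ^ b) x) = 0"
proof -
  have "(\<Sum>y\<in>cyc_group q. \<Sum>b\<in>{1..<q}. a (m(N := b)) * y ^ b) = 0" for m
    by (subst sum.swap) (simp add: sum_power_cyc_group flip: sum_distrib_left)
  then show ?thesis
    unfolding char_sum_def by (subst sum.swap) (simp flip: sum_distrib_right)
qed

lemma deg_le_upd_0:
  assumes "deg_le q (Suc N) d a" "q > 0"
  shows "deg_le q N d (\<lambda>m. a (m(N := 0)))"
  using assms multi_indices_upd[of _ q N 0] unfolding deg_le_def
  by (metis index_supp_upd)

text \<open>For \<open>b > 0\<close> the index \<open>m(N := b)\<close> has one active coordinate
  more than \<open>m\<close>.\<close>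

lemma deg_le_upd_pos:
  assumes "deg_le q (Suc N) (Suc d) a"
  shows "deg_le q N d (\<lambda>m. \<Sum>b\<in>{1..<q}. a (m(N := b)) * y ^ b)"
  unfolding deg_le_def
proof (intro ballI impI)
  fix m assume m: "m \<in> multi_indices q N" and nz: "(\<Sum>b\<in>{1..<q}. a (m(N := b)) * y ^ b) \<noteq> 0"
  from nz obtain b where b: "b \<in> {1..<q}" "a (m(N := b)) \<noteq> 0"
    by (metis (no_types, lifting) mult_zero_left sum.neutral)
  then have "card (index_supp (Suc N) (m(N := b))) \<le> Suc d"
    using assms m multi_indices_upd[of m q N b] unfolding deg_le_def by auto
  moreover have "N \<notin> index_supp N m"
    by (simp add: index_supp_def)
  ultimately show "card (index_supp N m) \<le> d"
    using b by (simp add: index_supp_upd)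
qed

lemma char_sum_upd_pos_deg_0:
  assumes "deg_le q (Suc N) 0 a" 
  shows "char_sum q N (\<lambda>m. \<Sum>b\<in>{1..<q}. a (m(N := b)) * y ^ b) x = 0"
proof -
  have "a (m(N := b)) = 0" if "m \<in> multi_indices q N" "b \<in> {1..<q}" for m b
  proof (rule ccontr)
    assume "a (m(N := b)) \<noteq> 0"
    then have "card (index_supp (Suc N) (m(N := b))) \<le> 0"
      using assms that multi_indices_upd[of m q N b] unfolding deg_le_def by auto
    then show False
      using that by (simp add: index_supp_upd)
  qed
  then show ?thesis
    unfolding char_sum_def by simp
qed

text \<open>The square of \<open>cmod (u + v)\<^sup>2\<close> is expanded. The term linear in
  \<open>v\<close> is kept exactly, since it will average to zero; the term cubic in
  \<open>v\<close> is absorbed into its neighbours by AM-GM.\<close>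

lemma norm_add_power4_le:
  fixes u v :: complex
  shows "cmod (u + v) ^ 4 \<le> cmod u ^ 4 + 4 * ((cmod u)\<^sup>2 * Re (u * cnj v)) +
    8 * ((cmod u)\<^sup>2 * (cmod v)\<^sup>2) + 3 * cmod v ^ 4"
proof -
  define r where "r = Re (u * cnj v)"
  have r: "\<bar>r\<bar> \<le> cmod u * cmod v"
    unfolding r_def by (metis abs_Re_le_cmod complex_mod_cnj norm_mult)
  then have r2: "r\<^sup>2 \<le> (cmod u)\<^sup>2 * (cmod v)\<^sup>2"
    by (metis abs_ge_zero power2_abs power_mono power_mult_distrib)
  have "(cmod (u + v))\<^sup>2 = (cmod u)\<^sup>2 + 2 * r + (cmod v)\<^sup>2"
    unfolding r_def cmod_power2 by (simp add: power2_eq_square algebra_simps)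
  then have "cmod (u + v) ^ 4 = ((cmod u)\<^sup>2 + 2 * r + (cmod v)\<^sup>2)\<^sup>2"
    by (metis numeral_Bit0 power_add power2_eq_square)
  also have "\<dots> = cmod u ^ 4 + 4 * ((cmod u)\<^sup>2 * r) + 2 * ((cmod u)\<^sup>2 * (cmod v)\<^sup>2) + 4 * r\<^sup>2 +
      4 * r * (cmod v)\<^sup>2 + cmod v ^ 4"
    by (simp add: power2_eq_square power4_eq_xxxx algebra_simps)
  also have "4 * r * (cmod v)\<^sup>2 \<le> 4 * (cmod u * cmod v) * (cmod v)\<^sup>2"
    using r by (intro mult_right_mono) auto
  also have "\<dots> \<le> 2 * ((cmod u)\<^sup>2 * (cmod v)\<^sup>2) + 2 * cmod v ^ 4"
  proof -
    have "0 \<le> 2 * (cmod v)\<^sup>2 * (cmod u - cmod v)\<^sup>2" by simp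
    then show ?thesis
      by (simp add: power2_eq_square power4_eq_xxxx algebra_simps)
  qed
  finally show ?thesis
    using r2 unfolding r_def by linarith
qed

lemma sum_power2_le_power2_sum:
  fixes f :: "'a \<Rightarrow> real"
  assumes "finite I" "\<And>i. i \<in> I \<Longrightarrow> 0 \<le> f i"
  shows "(\<Sum>i\<in>I. (f i)\<^sup>2) \<le> (\<Sum>i\<in>I. f i)\<^sup>2"
proof -
  have "(\<Sum>i\<in>I. (f i)\<^sup>2) \<le> (\<Sum>i\<in>I. f i * (\<Sum>i\<in>I. f i))"
    unfolding power2_eq_square
    using assms by (intro sum_mono mult_left_mono member_le_sum) auto
  then show ?thesis
    by (simp add: power2_eq_square sum_distrib_right)
qed

text \<open>
  Induction on \<open>N\<close>: the part \<open>h\<close> of the sum that involves the last variable \<open>y\<close> has degree at most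
  \<open>d - 1\<close> in the other variables and mean zero in \<open>y\<close>, and averaging the square of a function on
  \<open>q\<close> points loses at most a factor \<open>q\<close> against the square of the average.
\<close>

lemma hypercontractive_4_2:
  assumes "q > 0" "deg_le q N d a"
  shows "cube_avg q N (\<lambda>x. cmod (char_sum q N a x) ^ 4) \<le>
    (16 * real q) ^ d * (cube_avg q N (\<lambda>x. (cmod (char_sum q N a x))\<^sup>2))\<^sup>2"
  using assms(2)
proof (induction N arbitrary: d a)
  case 0
  have K: "1 \<le> (16 * real q) ^ d"
    using assms(1) by (intro one_le_power) linarith
  \<comment> \<open>For \<open>N = 0\<close> the cube has a single point, the function that is
    \<open>undefined\<close> everywhere.\<close>
  define s where "s = cmod (char_sum q 0 a (\<lambda>_. undefined))"
  have "s ^ 4 * 1 \<le> s ^ 4 * (16 * real q) ^ d"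
    using K by (intro mult_left_mono) auto
  then show ?case
    by (simp add: cube_avg_def cyc_cube_def s_def mult.commute)
next
  case (Suc N)
  define K where "K = 16 * real q"
  have Kpos: "K \<ge> 16" using assms(1) by (simp add: K_def)
  define C where "C = cyc_group q"
  define g where "g = char_sum q N (\<lambda>m. a (m(N := 0)))"
  define h where "h y = char_sum q N (\<lambda>m. \<Sum>b\<in>{1..<q}. a (m(N := b)) * y ^ b)" for y
  define A where "A = cube_avg q N (\<lambda>x. (cmod (g x))\<^sup>2)"
  define B where "B y = cube_avg q N (\<lambda>x. (cmod (h y x))\<^sup>2)" for y
  define S where "S = (\<Sum>y\<in>C. B y) / real q"
  have cardC: "real (card C) = real q" unfolding C_def using assms(1) by (simp add: card_cyc_group)
  have A0: "A \<ge> 0" and B0: "\<And>y. B y \<ge> 0"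
    unfolding A_def B_def by (auto intro!: cube_avg_nonneg)
  have S0: "S \<ge> 0" unfolding S_def using B0 by (auto intro!: divide_nonneg_nonneg sum_nonneg)
  have split: "char_sum q (Suc N) a (x(N := y)) = g x + h y x" for x y
    unfolding g_def h_def using char_sum_Suc[OF assms(1)] .
  have h0: "(\<Sum>y\<in>C. h y x) = 0" for x
    unfolding h_def C_def by (rule sum_char_sum_Suc_eq_0)
  have re0: "(\<Sum>y\<in>C. Re (g x * cnj (h y x))) = 0" for x
  proof -
    have "(\<Sum>y\<in>C. Re (g x * cnj (h y x))) = Re (g x * cnj (\<Sum>y\<in>C. h y x))"
      by (simp only: Re_sum cnj_sum sum_distrib_left)
    then show ?thesis using h0 by simp
  qed
  have g4: "cube_avg q N (\<lambda>x. cmod (g x) ^ 4) \<le> K ^ d * A\<^sup>2"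
    unfolding g_def A_def K_def
    by (rule Suc.IH[OF deg_le_upd_0[OF Suc.prems assms(1)]])
  \<comment> \<open>The degree of \<open>h y\<close> is one lower, which gains a factor
    \<open>K\<close> over the claimed constant; for \<open>d = 0\<close> there is no such degree,
    but then \<open>h y\<close> vanishes.\<close>
  have h4: "K * cube_avg q N (\<lambda>x. cmod (h y x) ^ 4) \<le> K ^ d * (B y)\<^sup>2" for y
  proof (cases d)
    case 0
    then have "h y x = 0" for x
      unfolding h_def using Suc.prems char_sum_upd_pos_deg_0 by blast
    then show ?thesis
      using 0 by (simp add: cube_avg_def B_def)
  next
    case (Suc d')
    have "cube_avg q N (\<lambda>x. cmod (h y x) ^ 4) \<le> K ^ d' * (B y)\<^sup>2"
      unfolding h_def B_def K_def
      using Suc.IH deg_le_upd_pos Suc.prems Suc by blast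
    then show ?thesis
      using Suc Kpos by (simp add: mult.assoc)
  qed
  \<comment> \<open>Cauchy-Schwarz, with the gain \<open>K \<ge> 16\<close> from \<open>h4\<close>.
    Its square root yields the factor 1/4, which turns the coefficient 8 of the mixed term into the
    2 of \<open>(A + S)\<^sup>2\<close>.\<close>
  have cross: "cube_avg q N (\<lambda>x. (cmod (g x))\<^sup>2 * (cmod (h y x))\<^sup>2) \<le> K ^ d / 4 * A * B y" for y
  proof (rule power2_le_imp_le)
    have "(cube_avg q N (\<lambda>x. (cmod (g x))\<^sup>2 * (cmod (h y x))\<^sup>2))\<^sup>2 \<le>
        cube_avg q N (\<lambda>x. cmod (g x) ^ 4) * cube_avg q N (\<lambda>x. cmod (h y x) ^ 4)"
      using cube_avg_Cauchy_Schwarz[of q N "\<lambda>x. (cmod (g x))\<^sup>2" "\<lambda>x. (cmod (h y x))\<^sup>2"]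
      by (simp flip: power_mult)
    also have "\<dots> \<le> (K ^ d * A\<^sup>2) * (K ^ d * (B y)\<^sup>2 / 16)"
    proof (intro mult_mono g4)
      have "16 * cube_avg q N (\<lambda>x. cmod (h y x) ^ 4) \<le> K * cube_avg q N (\<lambda>x. cmod (h y x) ^ 4)"
        using Kpos by (intro mult_right_mono cube_avg_nonneg) auto
      then show "cube_avg q N (\<lambda>x. cmod (h y x) ^ 4) \<le> K ^ d * (B y)\<^sup>2 / 16"
        using h4[of y] by simp
    qed (use Kpos in \<open>auto intro!: cube_avg_nonneg mult_nonneg_nonneg\<close>)
    also have "\<dots> = (K ^ d / 4 * A * B y)\<^sup>2"
      by (simp add: power2_eq_square)
    finally show "(cube_avg q N (\<lambda>x. (cmod (g x))\<^sup>2 * (cmod (h y x))\<^sup>2))\<^sup>2 \<le> (K ^ d / 4 * A * B y)\<^sup>2" .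
    show "0 \<le> K ^ d / 4 * A * B y"
      using A0 B0 Kpos by simp
  qed
  have sq: "cube_avg q (Suc N) (\<lambda>x. (cmod (char_sum q (Suc N) a x))\<^sup>2) = A + S"
  proof -
    have "(\<Sum>y\<in>C. (cmod (g x + h y x))\<^sup>2) = real q * (cmod (g x))\<^sup>2 + (\<Sum>y\<in>C. (cmod (h y x))\<^sup>2)" for x
    proof -
      have "(cmod (g x + h y x))\<^sup>2 = (cmod (g x))\<^sup>2 + 2 * Re (g x * cnj (h y x)) + (cmod (h y x))\<^sup>2" for y
        unfolding cmod_power2 by (simp add: power2_eq_square algebra_simps)
      then show ?thesis
        using re0[of x] cardC by (simp add: sum.distrib flip: sum_distrib_left)
    qed
    then have "cube_avg q (Suc N) (\<lambda>x. (cmod (char_sum q (Suc N) a x))\<^sup>2) = 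
       (cube_avg q N (\<lambda>x. real q * (cmod (g x))\<^sup>2 + (\<Sum>y\<in>C. (cmod (h y x))\<^sup>2))) / real q"
      unfolding cube_avg_Suc split by (simp add: C_def flip: cube_avg_sum)
    also have "\<dots> = A + S"
      unfolding cube_avg_add cube_avg_cmult cube_avg_sum A_def S_def B_def
      using assms(1) by (simp add: add_divide_distrib)
    finally show ?thesis .
  qed
  have "cube_avg q (Suc N) (\<lambda>x. cmod (char_sum q (Suc N) a x) ^ 4) =
      cube_avg q N (\<lambda>x. \<Sum>y\<in>C. cmod (g x + h y x) ^ 4) / real q"
    unfolding cube_avg_Suc split by (simp add: C_def flip: cube_avg_sum)
  also have "\<dots> \<le> cube_avg q N (\<lambda>x. real q * cmod (g x) ^ 4 +
      (\<Sum>y\<in>C. 8 * ((cmod (g x))\<^sup>2 * (cmod (h y x))\<^sup>2) + 3 * cmod (h y x) ^ 4)) / real q"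
  proof (intro divide_right_mono cube_avg_mono)
    fix x
    have "(\<Sum>y\<in>C. cmod (g x + h y x) ^ 4) \<le> (\<Sum>y\<in>C. cmod (g x) ^ 4 + 4 * ((cmod (g x))\<^sup>2 * Re (g x * cnj (h y x))) +
       (8 * ((cmod (g x))\<^sup>2 * (cmod (h y x))\<^sup>2) + 3 * cmod (h y x) ^ 4))"
      using norm_add_power4_le by (intro sum_mono) (simp add: add.assoc)
    also have "\<dots> = real q * cmod (g x) ^ 4 +
      (\<Sum>y\<in>C. 8 * ((cmod (g x))\<^sup>2 * (cmod (h y x))\<^sup>2) + 3 * cmod (h y x) ^ 4)"
      using re0[of x] cardC by (simp add: sum.distrib flip: sum_distrib_left)
    finally show "(\<Sum>y\<in>C. cmod (g x + h y x) ^ 4) \<le> \<dots>" .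
  qed simp
  also have "\<dots> = cube_avg q N (\<lambda>x. cmod (g x) ^ 4) +
      (8 * (\<Sum>y\<in>C. cube_avg q N (\<lambda>x. (cmod (g x))\<^sup>2 * (cmod (h y x))\<^sup>2)) +
       3 * (\<Sum>y\<in>C. cube_avg q N (\<lambda>x. cmod (h y x) ^ 4))) / real q"
    unfolding cube_avg_add cube_avg_cmult cube_avg_sum
    using assms(1) by (simp add: add_divide_distrib sum.distrib sum_distrib_left)
  also have "\<dots> \<le> K ^ d * A\<^sup>2 + (8 * (\<Sum>y\<in>C. K ^ d / 4 * A * B y) +
      3 * (\<Sum>y\<in>C. K ^ d * (B y)\<^sup>2 / K)) / real q"
  proof (intro add_mono g4 divide_right_mono mult_left_mono sum_mono cross)
    show "cube_avg q N (\<lambda>x. cmod (h y x) ^ 4) \<le> K ^ d * (B y)\<^sup>2 / K" for y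
      using h4[of y] Kpos by (simp add: field_simps)
  qed auto
  also have "\<dots> = K ^ d * (A\<^sup>2 + 2 * A * S + 3 * (\<Sum>y\<in>C. (B y)\<^sup>2) / (K * real q))"
  proof -
    have s1: "(\<Sum>y\<in>C. K ^ d / 4 * A * B y) = K ^ d / 4 * A * (S * real q)"
      unfolding S_def using assms(1) sum_distrib_left[of "K ^ d / 4 * A" B C] by simp
    have s2: "(\<Sum>y\<in>C. K ^ d * (B y)\<^sup>2 / K) = K ^ d * (\<Sum>y\<in>C. (B y)\<^sup>2) / K"
      by (simp add: sum_distrib_left sum_divide_distrib)
    show ?thesis
      unfolding s1 s2 using assms(1) Kpos by (simp add: field_simps)
  qed
  \<comment> \<open>This is where \<open>q\<close> enters \<open>K\<close>: the sum of the
    \<open>(B y)\<^sup>2\<close> can be as large as \<open>q\<^sup>2 * S\<^sup>2\<close>, and the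
    divisor \<open>K * q = 16 * q\<^sup>2\<close> compensates.\<close>
  also have "\<dots> \<le> K ^ d * (A\<^sup>2 + 2 * A * S + S\<^sup>2)"
  proof -
    have "(\<Sum>y\<in>C. (B y)\<^sup>2) \<le> (S * real q)\<^sup>2"
      using sum_power2_le_power2_sum[of C B] B0 assms(1) by (simp add: S_def C_def)
    then have "3 * (\<Sum>y\<in>C. (B y)\<^sup>2) \<le> S\<^sup>2 * (K * real q)"
      using sum_nonneg[of C "\<lambda>y. (B y)\<^sup>2"] by (simp add: K_def power2_eq_square algebra_simps)
    then have "3 * (\<Sum>y\<in>C. (B y)\<^sup>2) / (K * real q) \<le> S\<^sup>2"
      using Kpos assms(1) by (simp add: divide_le_eq)
    then show ?thesis
      using Kpos by (intro mult_left_mono add_left_mono) auto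
  qed
  also have "\<dots> = K ^ d * (A + S)\<^sup>2"
    by (simp add: power2_eq_square algebra_simps)
  finally show ?case
    unfolding sq K_def .
qed

text \<open>Moments are interpolated: with \<open>E k\<close> the \<open>k\<close>-th absolute
  moment, \<open>(E 2) ^ 4 \<le> (E 1)\<^sup>2 * (E 3)\<^sup>2 \<le> (E 1)\<^sup>2 * E 2 * E
  4\<close>, and after inserting the bound on \<open>E 4\<close> the factor \<open>(E 2) ^ 3\<close>
  cancels.\<close>

lemma hypercontractive_2_1:
  assumes "q > 0" "deg_le q N d a"
  shows "cube_avg q N (\<lambda>x. (cmod (char_sum q N a x))\<^sup>2) \<le>
    (16 * real q) ^ d * (cube_avg q N (\<lambda>x. cmod (char_sum q N a x)))\<^sup>2"
proof -
  define g where "g x = cmod (char_sum q N a x)" for x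
  define E where "E k = cube_avg q N (\<lambda>x. g x ^ k)" for k
  have g0: "g x \<ge> 0" for x by (simp add: g_def)
  have E0: "E k \<ge> 0" for k
    unfolding E_def using g0 by (intro cube_avg_nonneg) auto
  have CS: "(cube_avg q N (\<lambda>x. sqrt (g x) ^ i * sqrt (g x) ^ j))\<^sup>2 \<le> E i * E j" for i j
    using cube_avg_Cauchy_Schwarz[of q N "\<lambda>x. sqrt (g x) ^ i" "\<lambda>x. sqrt (g x) ^ j"] g0
    by (simp add: E_def flip: power_mult) (simp add: power_mult mult.commute[of _ 2])
  have g2: "sqrt (g x) ^ 1 * sqrt (g x) ^ 3 = g x ^ 2" "sqrt (g x) ^ 2 * sqrt (g x) ^ 4 = g x ^ 3" for x
  proof -
    have even_pow: "sqrt (g x) ^ (2 * k) = g x ^ k" for k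
      using g0 by (simp add: power_mult)
    have "sqrt (g x) ^ 1 * sqrt (g x) ^ 3 = sqrt (g x) ^ (2 * 2)"
      "sqrt (g x) ^ 2 * sqrt (g x) ^ 4 = sqrt (g x) ^ (2 * 3)"
      by (simp_all flip: power_add power_Suc)
    then show "sqrt (g x) ^ 1 * sqrt (g x) ^ 3 = g x ^ 2" "sqrt (g x) ^ 2 * sqrt (g x) ^ 4 = g x ^ 3"
      unfolding even_pow .
  qed
  have 1: "(E 2)\<^sup>2 \<le> E 1 * E 3" and 2: "(E 3)\<^sup>2 \<le> E 2 * E 4"
    using CS[of 1 3] CS[of 2 4] unfolding g2 E_def by auto
  have 3: "E 4 \<le> (16 * real q) ^ d * (E 2)\<^sup>2"
    unfolding E_def g_def using hypercontractive_4_2[OF assms] .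
  have "E 2 \<le> (16 * real q) ^ d * (E 1)\<^sup>2"
  proof (cases "E 2 = 0")
    case True
    then show ?thesis using E0 by simp
  next
    case False
    then have pos: "E 2 > 0" using E0[of 2] by simp
    have "(E 2) ^ 3 * E 2 = ((E 2)\<^sup>2)\<^sup>2"
      by (simp flip: power_mult power_Suc2)
    also have "\<dots> \<le> (E 1 * E 3)\<^sup>2"
      using 1 E0 by (intro power_mono) auto
    also have "\<dots> = (E 1)\<^sup>2 * (E 3)\<^sup>2"
      by (simp add: power_mult_distrib)
    also have "\<dots> \<le> (E 1)\<^sup>2 * (E 2 * ((16 * real q) ^ d * (E 2)\<^sup>2))"
      using 2 3 E0[of 2] by (intro mult_left_mono order.trans[OF 2]) auto
    also have "\<dots> = (E 2) ^ 3 * ((16 * real q) ^ d * (E 1)\<^sup>2)"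
      by (simp add: power2_eq_square power3_eq_cube)
    finally show ?thesis
      using pos by (simp add: mult_le_cancel_left)
  qed
  then show ?thesis
    unfolding E_def g_def by simp
qed

section \<open>Fourier coefficients\<close>

text \<open>Stated for any orthogonal family, because it serves both the characters of the cube and
  the rows of the discrete Fourier matrix.\<close>

lemma orthogonal_parseval:
  fixes a :: "'i \<Rightarrow> complex" and \<phi> :: "'i \<Rightarrow> 'x \<Rightarrow> complex"
  assumes "finite I"
    and "\<And>i j. i \<in> I \<Longrightarrow> j \<in> I \<Longrightarrow> (\<Sum>x\<in>X. \<phi> i x * cnj (\<phi> j x)) = (if i = j then of_real c else 0)"
  shows "(\<Sum>x\<in>X. (cmod (\<Sum>i\<in>I. a i * \<phi> i x))\<^sup>2) = c * (\<Sum>i\<in>I. (cmod (a i))\<^sup>2)"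
proof -
  have "of_real (\<Sum>x\<in>X. (cmod (\<Sum>i\<in>I. a i * \<phi> i x))\<^sup>2) =
      (\<Sum>x\<in>X. (\<Sum>i\<in>I. a i * \<phi> i x) * cnj (\<Sum>j\<in>I. a j * \<phi> j x))"
    by (simp only: of_real_sum complex_norm_square)
  also have "\<dots> = (\<Sum>x\<in>X. \<Sum>i\<in>I. \<Sum>j\<in>I. a i * cnj (a j) * (\<phi> i x * cnj (\<phi> j x)))"
    by (simp add: cnj_sum sum_product mult_ac)
  also have "\<dots> = (\<Sum>i\<in>I. \<Sum>j\<in>I. a i * cnj (a j) * (\<Sum>x\<in>X. \<phi> i x * cnj (\<phi> j x)))"
    by (subst sum.swap, rule sum.cong[OF refl], subst sum.swap) (simp add: sum_distrib_left)
  also have "\<dots> = (\<Sum>i\<in>I. \<Sum>j\<in>I. if i = j then a i * cnj (a j) * of_real c else 0)"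
    using assms(2) by (intro sum.cong refl) auto
  also have "\<dots> = (\<Sum>i\<in>I. a i * cnj (a i) * of_real c)"
    using assms(1) by simp
  also have "\<dots> = of_real (c * (\<Sum>i\<in>I. (cmod (a i))\<^sup>2))"
    by (simp only: of_real_mult of_real_sum complex_norm_square) (simp add: sum_distrib_left mult_ac)
  finally show ?thesis
    using of_real_eq_iff by blast
qed

lemma cube_avg_char_sum_parseval:
  assumes "q > 0"
  shows "cube_avg q N (\<lambda>x. (cmod (char_sum q N a x))\<^sup>2) = (\<Sum>m\<in>multi_indices q N. (cmod (a m))\<^sup>2)"
proof -
  have "(\<Sum>x\<in>cyc_cube q N. (cmod (char_sum q N a x))\<^sup>2) =
      real q ^ N * (\<Sum>m\<in>multi_indices q N. (cmod (a m))\<^sup>2)"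
    unfolding char_sum_def by (rule orthogonal_parseval) (auto simp: character_orthogonal)
  then show ?thesis
    using assms by (simp add: cube_avg_def)
qed

lemma fourier_coeff_char_sum:
  assumes "q > 0" "\<And>x. x \<in> cyc_cube q N \<Longrightarrow> f x = char_sum q N a x" "m \<in> multi_indices q N"
  shows "fourier_coeff q N f m = a m"
proof -
  have "(\<Sum>x\<in>cyc_cube q N. f x * cnj (character N m x)) =
      (\<Sum>x\<in>cyc_cube q N. \<Sum>n\<in>multi_indices q N. a n * (character N n x * cnj (character N m x)))"
    using assms(2) by (simp add: char_sum_def sum_distrib_right mult.assoc)
  also have "\<dots> = (\<Sum>n\<in>multi_indices q N. a n * (if n = m then of_nat q ^ N else 0))"
    using character_orthogonal[OF _ assms(3)]
    by (subst sum.swap) (simp flip: sum_distrib_left)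
  also have "\<dots> = (\<Sum>n\<in>multi_indices q N. if n = m then a n * of_nat q ^ N else 0)"
    by (intro sum.cong) auto
  also have "\<dots> = a m * of_nat q ^ N"
    using assms(3) by simp
  finally show ?thesis
    using assms(1) by (simp add: fourier_coeff_def)
qed

section \<open>The space of low-degree functions and its norm\<close>

lemma low_indices_subset: "low_indices q N d \<subseteq> multi_indices q N"
  by (auto simp: low_indices_def)

lemma char_sum_low_indices:
  assumes "deg_le q N d a"
  shows "char_sum q N a x = (\<Sum>m\<in>low_indices q N d. a m * character N m x)"
  unfolding char_sum_def using assms low_indices_subset
  by (intro sum.mono_neutral_right) (auto simp: deg_le_def low_indices_def)

lemma low_degree_iff:
  "f \<in> low_degree q N d \<longleftrightarrow> (\<exists>a. deg_le q N d a \<and> (\<forall>x\<in>cyc_cube q N. f x = char_sum q N a x))"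
proof
  assume "f \<in> low_degree q N d"
  then obtain a where a: "\<forall>x\<in>cyc_cube q N. f x = (\<Sum>m\<in>low_indices q N d. a m * character N m x)"
    unfolding low_degree_def by blast
  \<comment> \<open>The span leaves the coefficients outside \<open>low_indices\<close> arbitrary;
    \<open>deg_le\<close> wants them to be zero.\<close>
  define b where "b m = (if m \<in> low_indices q N d then a m else 0)" for m
  have "deg_le q N d b"
    by (auto simp: deg_le_def b_def low_indices_def)
  moreover from this have "\<forall>x\<in>cyc_cube q N. f x = char_sum q N b x"
    using a by (simp add: char_sum_low_indices b_def)
  ultimately show "\<exists>a. deg_le q N d a \<and> (\<forall>x\<in>cyc_cube q N. f x = char_sum q N a x)"
    by blast
next
  assume "\<exists>a. deg_le q N d a \<and> (\<forall>x\<in>cyc_cube q N. f x = char_sum q N a x)"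
  then show "f \<in> low_degree q N d"
    unfolding low_degree_def using char_sum_low_indices by fastforce
qed

lemma norm_le_sup_norm: "x \<in> cyc_cube q N \<Longrightarrow> cmod (f x) \<le> sup_norm q N f"
  unfolding sup_norm_def by (intro Max_ge) auto

lemma sup_norm_le:
  "q > 0 \<Longrightarrow> (\<And>x. x \<in> cyc_cube q N \<Longrightarrow> cmod (f x) \<le> B) \<Longrightarrow> sup_norm q N f \<le> B"
  unfolding sup_norm_def by (subst Max_le_iff) (auto simp: cyc_cube_nonempty)

section \<open>Single coordinate changes\<close>

text \<open>A shift preserves the leading coefficient. The zero polynomial is listed apart because
  its \<open>degree\<close> is 0, so that for \<open>d = 0\<close> the conclusion says that the
  difference vanishes.\<close>

lemma poly_shift_diff_degree:
  fixes p :: "'a::idom poly"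
  assumes "p = 0 \<or> degree p < Suc d"
  shows "p - p \<circ>\<^sub>p [:h, 1:] = 0 \<or> degree (p - p \<circ>\<^sub>p [:h, 1:]) < d"
proof (cases "degree p = 0")
  case True
  then obtain c where "p = [:c:]" by (rule degree_eq_zeroE)
  then show ?thesis by simp
next
  case False
  define r where "r = p - p \<circ>\<^sub>p [:h, 1:]"
  have deg: "degree (p \<circ>\<^sub>p [:h, 1:]) \<le> degree p"
    using degree_pcompose_le[of p "[:h, 1:]"] by simp
  then have "degree r \<le> degree p"
    unfolding r_def by (intro degree_diff_le) auto
  moreover have "coeff r (degree p) = 0"
    using lead_coeff_comp[of "[:h, 1:]" p] degree_pcompose[of p "[:h, 1:]"] by (simp add: r_def)
  ultimately have "r = 0 \<or> degree r < degree p"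
    using eq_zero_or_degree_less by blast
  then show ?thesis
    using assms False unfolding r_def by auto
qed

text \<open>The \<open>d\<close>-th finite difference kills polynomials of degree below
  \<open>d\<close>: Pascal's rule turns a difference of order \<open>Suc d\<close> of
  \<open>p\<close> into one of order \<open>d\<close> of
  \<open>p - p \<circ>\<^sub>p [:h, 1:]\<close>.\<close>

lemma alternating_binomial_poly_sum:
  fixes p :: "'a::idom poly"
  assumes "p = 0 \<or> degree p < d"
  shows "(\<Sum>i\<le>d. (-1) ^ i * of_nat (d choose i) * poly p (of_nat i * h)) = 0"
  using assms
proof (induction d arbitrary: p)
  case 0
  then show ?case by simp
next
  case (Suc d)
  define g where "g i = poly p (of_nat i * h)" for i
  have "(\<Sum>i\<le>Suc d. (-1) ^ i * of_nat (Suc d choose i) * g i) =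
      g 0 + (\<Sum>i\<le>d. (-1) ^ Suc i * of_nat (Suc d choose Suc i) * g (Suc i))"
    by (simp add: sum.atMost_Suc_shift del: sum.atMost_Suc binomial_Suc_Suc)
  also have "\<dots> = (g 0 + (\<Sum>i\<le>d. (-1) ^ Suc i * of_nat (d choose Suc i) * g (Suc i))) -
      (\<Sum>i\<le>d. (-1) ^ i * of_nat (d choose i) * g (Suc i))"
    by (simp add: sum.distrib[symmetric] sum_subtractf[symmetric] algebra_simps sum_negf)
  also have "g 0 + (\<Sum>i\<le>d. (-1) ^ Suc i * of_nat (d choose Suc i) * g (Suc i)) =
      (\<Sum>i\<le>Suc d. (-1) ^ i * of_nat (d choose i) * g i)"
    by (simp add: sum.atMost_Suc_shift del: sum.atMost_Suc)
  also have "\<dots> = (\<Sum>i\<le>d. (-1) ^ i * of_nat (d choose i) * g i)"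
    using binomial_eq_0[of d "Suc d"] by (simp del: binomial_eq_0_iff)
  also have "(\<Sum>i\<le>d. (-1) ^ i * of_nat (d choose i) * g i) -
      (\<Sum>i\<le>d. (-1) ^ i * of_nat (d choose i) * g (Suc i)) =
      (\<Sum>i\<le>d. (-1) ^ i * of_nat (d choose i) * poly (p - p \<circ>\<^sub>p [:h, 1:]) (of_nat i * h))"
    by (simp add: g_def poly_pcompose sum_subtractf[symmetric] algebra_simps)
  also have "\<dots> = 0"
    using Suc.IH poly_shift_diff_degree Suc.prems by blast
  finally show ?case
    unfolding g_def .
qed

text \<open>Write \<open>p = c + X * r\<close>, so that the coefficient is \<open>r(0)\<close>. As
  \<open>r\<close> has degree below \<open>d\<close>, its vanishing \<open>d\<close>-th difference
  expresses \<open>r(0)\<close> through the values at \<open>i / d\<close> for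
  \<open>1 \<le> i \<le> d\<close>. There \<open>r(t) = (p(t) - p(0)) / t\<close> is at most
  \<open>2 * d * M\<close>, and the binomial weights add up to at most \<open>2 ^ d\<close>.\<close>

lemma coeff_1_bound:
  fixes p :: "complex poly"
  assumes "degree p \<le> d" "d \<ge> 1"
    and "\<And>t. 0 \<le> t \<Longrightarrow> t \<le> 1 \<Longrightarrow> cmod (poly p (of_real t)) \<le> M"
  shows "cmod (coeff p 1) \<le> 2 * real d * 2 ^ d * M"
proof -
  obtain c r where p: "p = pCons c r" by (rule pCons_cases)
  have M0: "M \<ge> 0"
    using order.trans[OF norm_ge_zero assms(3)[of 0]] by simp
  have "r = 0 \<or> degree r < d"
    using assms(1) unfolding p by (auto split: if_splits)
  then have "(\<Sum>i\<le>d. (-1) ^ i * of_nat (d choose i) * poly r (of_nat i * of_real (1 / real d))) = 0"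
    by (rule alternating_binomial_poly_sum)
  moreover have "{..d} = insert 0 {1..d}" by auto
  ultimately have "coeff p 1 = - (\<Sum>i\<in>{1..d}. (-1) ^ i * of_nat (d choose i) * poly r (of_nat i * of_real (1 / real d)))"
    by (simp add: p poly_0_coeff_0 eq_neg_iff_add_eq_0)
  then have "cmod (coeff p 1) \<le> (\<Sum>i\<in>{1..d}. cmod ((-1) ^ i * of_nat (d choose i) * poly r (of_nat i * of_real (1 / real d))))"
    by (simp add: norm_sum del: One_nat_def)
  also have "\<dots> \<le> (\<Sum>i\<in>{1..d}. real (d choose i) * (2 * real d * M))"
  proof (rule sum_mono)
    fix i assume i: "i \<in> {1..d}"
    define t where "t = real i / real d"
    have t: "0 < t" "t \<le> 1" "1 / real d \<le> t"
      using i assms(2) by (auto simp: t_def divide_simps)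
    have "of_real t * poly r (of_real t) = poly p (of_real t) - poly p (of_real 0)"
      by (simp add: p)
    then have "t * cmod (poly r (of_real t)) = cmod (poly p (of_real t) - poly p (of_real 0))"
      using t by (metis abs_of_pos norm_mult norm_of_real)
    also have "\<dots> \<le> M + M"
      using t by (intro order.trans[OF norm_triangle_ineq4] add_mono assms(3)) auto
    finally have "t * cmod (poly r (of_real t)) \<le> 2 * M" by simp
    moreover have "1 / real d * cmod (poly r (of_real t)) \<le> t * cmod (poly r (of_real t))"
      using t by (intro mult_right_mono) auto
    ultimately have "1 / real d * cmod (poly r (of_real t)) \<le> 2 * M"
      by linarith
    then have "cmod (poly r (of_real t)) \<le> 2 * real d * M"
      using assms(2) by (simp add: divide_le_eq mult_ac)
    then show "cmod ((-1) ^ i * of_nat (d choose i) * poly r (of_nat i * of_real (1 / real d))) \<le>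
        real (d choose i) * (2 * real d * M)"
      by (simp add: norm_mult norm_power t_def mult_left_mono)
  qed
  also have "\<dots> \<le> (\<Sum>i\<le>d. real (d choose i) * (2 * real d * M))"
    using M0 by (intro sum_mono2) auto
  also have "\<dots> = 2 * real d * 2 ^ d * M"
    using choose_row_sum[of d] by (simp flip: sum_distrib_right of_nat_sum)
  finally show ?thesis .
qed

text \<open>For real numbers the subsets of the nonnegative and of the negative terms suffice and
  cost a factor 2; real and imaginary parts are treated separately.\<close>

lemma sum_cmod_le_subset_sums:
  fixes c :: "'i \<Rightarrow> complex"
  assumes "finite I" "\<And>J. J \<subseteq> I \<Longrightarrow> cmod (\<Sum>j\<in>J. c j) \<le> B"
  shows "(\<Sum>j\<in>I. cmod (c j)) \<le> 4 * B"
proof -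
  have real_part: "(\<Sum>j\<in>I. \<bar>g j\<bar>) \<le> 2 * B"
    if g: "\<And>J. J \<subseteq> I \<Longrightarrow> \<bar>\<Sum>j\<in>J. g j\<bar> \<le> B" for g :: "'i \<Rightarrow> real"
  proof -
    have "(\<Sum>j\<in>I. \<bar>g j\<bar>) = (\<Sum>j\<in>{j\<in>I. g j \<ge> 0}. \<bar>g j\<bar>) + (\<Sum>j\<in>I - {j\<in>I. g j \<ge> 0}. \<bar>g j\<bar>)"
      using assms(1) by (subst sum.subset_diff[of "{j\<in>I. g j \<ge> 0}" I]) auto
    also have "(\<Sum>j\<in>I - {j\<in>I. g j \<ge> 0}. \<bar>g j\<bar>) = (\<Sum>j\<in>I - {j\<in>I. g j \<ge> 0}. - g j)"
      by (intro sum.cong) auto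
    also have "(\<Sum>j\<in>{j\<in>I. g j \<ge> 0}. \<bar>g j\<bar>) + \<dots> =
        (\<Sum>j\<in>{j\<in>I. g j \<ge> 0}. g j) - (\<Sum>j\<in>I - {j\<in>I. g j \<ge> 0}. g j)"
      by (simp add: sum_negf)
    also have "\<dots> \<le> 2 * B"
      using g[of "{j\<in>I. g j \<ge> 0}"] g[of "I - {j\<in>I. g j \<ge> 0}"] by auto
    finally show ?thesis .
  qed
  have "(\<Sum>j\<in>I. cmod (c j)) \<le> (\<Sum>j\<in>I. \<bar>Re (c j)\<bar>) + (\<Sum>j\<in>I. \<bar>Im (c j)\<bar>)"
    unfolding sum.distrib[symmetric] by (intro sum_mono cmod_le)
  also have "(\<Sum>j\<in>I. \<bar>Re (c j)\<bar>) \<le> 2 * B"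
    using assms(2) by (intro real_part) (metis Re_sum abs_Re_le_cmod order.trans)
  also have "(\<Sum>j\<in>I. \<bar>Im (c j)\<bar>) \<le> 2 * B"
    using assms(2) by (intro real_part) (metis Im_sum abs_Im_le_cmod order.trans)
  finally show ?thesis by simp
qed

text \<open>
  Coordinate \<open>j \<in> J\<close> is moved from \<open>x j\<close> to \<open>y j\<close> with probability \<open>t\<close>, independently. The
  expected value of the character sum is a polynomial in \<open>t\<close>, bounded on \<open>[0, 1]\<close>.
\<close>

definition mix_poly :: "nat \<Rightarrow> nat set \<Rightarrow> (nat \<Rightarrow> complex) \<Rightarrow> (nat \<Rightarrow> complex) \<Rightarrow> (nat \<Rightarrow> nat) \<Rightarrow> complex poly" where
  "mix_poly N J x y m =
    (\<Prod>j<N. [:x j ^ m j, if j \<in> J then y j ^ m j - x j ^ m j else 0:])"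

text \<open>For \<open>m j = 0\<close> the linear coefficient \<open>y j ^ 0 - x j ^ 0\<close>
  vanishes, so only active coordinates contribute to the degree.\<close>

lemma degree_mix_poly: "degree (mix_poly N J x y m) \<le> card (index_supp N m)"
proof -
  have "degree (mix_poly N J x y m) \<le>
      (\<Sum>j<N. degree [:x j ^ m j, if j \<in> J then y j ^ m j - x j ^ m j else 0:])"
    unfolding mix_poly_def by (rule degree_prod_sum_le[unfolded o_def]) simp
  also have "\<dots> \<le> (\<Sum>j<N. if m j \<noteq> 0 then 1 else 0)"
    by (intro sum_mono) (auto intro: Nat.gr0I)
  also have "\<dots> = card (index_supp N m)"
    by (simp add: sum.If_cases index_supp_def Int_def lessThan_def)
  finally show ?thesis .
qed

text \<open>The probability that the random point equals \<open>z\<close>. The two cases are added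
  rather than nested, so that for \<open>x j = y j = z j\<close> the factor is 1.\<close>

definition mix_weight :: "nat \<Rightarrow> nat set \<Rightarrow> (nat \<Rightarrow> complex) \<Rightarrow> (nat \<Rightarrow> complex) \<Rightarrow> real \<Rightarrow> (nat \<Rightarrow> complex) \<Rightarrow> real" where
  "mix_weight N J x y t z = (\<Prod>j<N. (if z j = x j then 1 - (if j \<in> J then t else 0) else 0) +
    (if z j = y j then (if j \<in> J then t else 0) else 0))"

lemma mix_weight_nonneg: "0 \<le> t \<Longrightarrow> t \<le> 1 \<Longrightarrow> 0 \<le> mix_weight N J x y t z"
  unfolding mix_weight_def by (intro prod_nonneg ballI add_nonneg_nonneg) auto

text \<open>Independence of the coordinates: a product of one-coordinate expectations expands into
  an expectation over the whole cube.\<close>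

lemma poly_mix_poly_convex:
  assumes "x \<in> cyc_cube q N" "y \<in> cyc_cube q N"
  shows "poly (mix_poly N J x y m) (of_real t) =
    (\<Sum>z\<in>cyc_cube q N. of_real (mix_weight N J x y t z) * character N m z)"
proof -
  define s where "s j = (if j \<in> J then t else 0)" for j
  define v where "v j z = (if z = x j then 1 - s j else 0) + (if z = y j then s j else 0)" for j z
  have "poly (mix_poly N J x y m) (of_real t) = (\<Prod>j<N. of_real (1 - s j) * x j ^ m j + of_real (s j) * y j ^ m j)"
    unfolding mix_poly_def poly_prod by (intro prod.cong) (auto simp: s_def algebra_simps)
  also have "\<dots> = (\<Prod>j<N. \<Sum>z\<in>cyc_group q. of_real (v j z) * z ^ m j)"
  proof (rule prod.cong[OF refl])
    fix j assume "j \<in> {..<N}"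
    then have xy: "x j \<in> cyc_group q" "y j \<in> cyc_group q"
      using assms cyc_cube_nth by auto
    have "(\<Sum>z\<in>cyc_group q. of_real (v j z) * z ^ m j) =
        (\<Sum>z\<in>cyc_group q. if z = x j then of_real (1 - s j) * z ^ m j else 0) +
        (\<Sum>z\<in>cyc_group q. if z = y j then of_real (s j) * z ^ m j else 0)"
      unfolding sum.distrib[symmetric] v_def by (intro sum.cong) (auto simp: algebra_simps)
    then show "of_real (1 - s j) * x j ^ m j + of_real (s j) * y j ^ m j =
        (\<Sum>z\<in>cyc_group q. of_real (v j z) * z ^ m j)"
      using xy by simp
  qed
  also have "\<dots> = (\<Sum>z\<in>cyc_cube q N. \<Prod>j<N. of_real (v j (z j)) * z j ^ m j)"
    unfolding cyc_cube_def by (subst prod_sum_PiE) auto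
  also have "\<dots> = (\<Sum>z\<in>cyc_cube q N. of_real (mix_weight N J x y t z) * character N m z)"
    unfolding character_def prod.distrib mix_weight_def v_def s_def by (simp only: of_real_prod)
  finally show ?thesis .
qed

text \<open>The product rule, the coefficient being the derivative at 0.\<close>

lemma coeff_1_prod_linear:
  fixes a b :: "'i \<Rightarrow> 'a::idom"
  assumes "finite I"
  shows "coeff (\<Prod>j\<in>I. [:a j, b j:]) 1 = (\<Sum>j\<in>I. b j * (\<Prod>i\<in>I - {j}. a i))"
proof -
  have "coeff p 1 = poly (pderiv p) 0" for p :: "'a poly"
    by (simp add: poly_0_coeff_0 coeff_pderiv)
  then show ?thesis
    by (simp add: pderiv_prod poly_sum poly_prod pderiv_pCons mult.commute)
qed

lemma character_upd_factor:
  assumes "j < N"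
  shows "character N m (x(j := y)) = y ^ m j * (\<Prod>i\<in>{..<N} - {j}. x i ^ m i)"
  unfolding character_def using assms by (subst prod.remove[of _ j]) auto

lemma character_upd_diff:
  assumes "j < N"
  shows "(y ^ m j - x j ^ m j) * (\<Prod>i\<in>{..<N} - {j}. x i ^ m i) =
    character N m (x(j := y)) - character N m x"
  using character_upd_factor[OF assms, of m x y] character_upd_factor[OF assms, of m x "x j"]
  by (simp add: algebra_simps)

text \<open>\<open>coeff_1_bound\<close> is applied for every subset \<open>J\<close> of the
  coordinates, which gives the factor 2; passing from subset sums to absolute values gives the
  factor 4.\<close>

lemma sum_single_changes_bound:
  assumes "q > 0" "d \<ge> 1" "deg_le q N d a" "x \<in> cyc_cube q N" "y \<in> cyc_cube q N"
    and M: "\<And>z. z \<in> cyc_cube q N \<Longrightarrow> cmod (char_sum q N a z) \<le> M"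
  shows "(\<Sum>j<N. cmod (char_sum q N a (x(j := y j)) - char_sum q N a x)) \<le> 8 * real d * 2 ^ d * M"
proof -
  have "cmod (\<Sum>j\<in>J. char_sum q N a (x(j := y j)) - char_sum q N a x) \<le> 2 * real d * 2 ^ d * M"
    if J: "J \<subseteq> {..<N}" for J
  proof -
    define P where "P = (\<Sum>m\<in>multi_indices q N. smult (a m) (mix_poly N J x y m))"
    have "degree P \<le> d"
      unfolding P_def
    proof (rule degree_sum_le)
      fix m assume m: "m \<in> multi_indices q N"
      show "degree (smult (a m) (mix_poly N J x y m)) \<le> d"
      proof (cases "a m = 0")
        case False
        then show ?thesis
          using assms(3) m degree_mix_poly[of N J x y m] unfolding deg_le_def by fastforce
      qed simp
    qed simp
    moreover have "cmod (poly P (of_real t)) \<le> M" if t: "0 \<le> t" "t \<le> 1" for t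
    proof -
      define w where "w = mix_weight N J x y t"
      have w0: "0 \<le> w z" for z
        unfolding w_def using t by (rule mix_weight_nonneg)
      have mix: "poly (mix_poly N J x y m) (of_real t) = (\<Sum>z\<in>cyc_cube q N. of_real (w z) * character N m z)" for m
        unfolding w_def using assms(4,5) by (rule poly_mix_poly_convex)
      \<comment> \<open>The total weight is the expectation of the trivial character, whose
        polynomial is the constant 1.\<close>
      have "(\<Sum>z\<in>cyc_cube q N. w z) = 1"
      proof -
        have "of_real (\<Sum>z\<in>cyc_cube q N. w z) = poly (mix_poly N J x y (\<lambda>_. 0)) (of_real t)"
          unfolding mix by (simp add: character_def)
        also have "\<dots> = 1"
          unfolding mix_poly_def poly_prod by (intro prod.neutral) auto
        finally show ?thesis
          using of_real_eq_1_iff by blast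
      qed
      note w1 = this
      have "poly P (of_real t) = (\<Sum>z\<in>cyc_cube q N. of_real (w z) * char_sum q N a z)"
        unfolding P_def poly_sum poly_smult mix char_sum_def sum_distrib_left
        by (subst sum.swap) (simp add: mult.left_commute)
      then have "cmod (poly P (of_real t)) \<le> (\<Sum>z\<in>cyc_cube q N. w z * M)"
        using w0 M by (simp add: norm_mult sum_norm_le mult_left_mono)
      then show ?thesis
        using w1 by (simp flip: sum_distrib_right)
    qed
    ultimately have "cmod (coeff P 1) \<le> 2 * real d * 2 ^ d * M"
      using assms(2) coeff_1_bound by blast
    moreover have "coeff P 1 = (\<Sum>j\<in>J. char_sum q N a (x(j := y j)) - char_sum q N a x)"
    proof -
      have "coeff (mix_poly N J x y m) 1 = (\<Sum>j\<in>J. character N m (x(j := y j)) - character N m x)" for m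
      proof -
        have "coeff (mix_poly N J x y m) 1 =
            (\<Sum>j<N. (if j \<in> J then y j ^ m j - x j ^ m j else 0) * (\<Prod>i\<in>{..<N} - {j}. x i ^ m i))"
          unfolding mix_poly_def by (rule coeff_1_prod_linear) simp
        also have "\<dots> = (\<Sum>j\<in>J. (y j ^ m j - x j ^ m j) * (\<Prod>i\<in>{..<N} - {j}. x i ^ m i))"
          using J by (intro sum.mono_neutral_cong_right) auto
        finally show ?thesis
          using J character_upd_diff[of _ N] by (auto intro!: sum.cong)
      qed
      then have "coeff P 1 = (\<Sum>m\<in>multi_indices q N. a m * (\<Sum>j\<in>J. character N m (x(j := y j)) - character N m x))"
        by (simp add: P_def coeff_sum)
      also have "\<dots> = (\<Sum>j\<in>J. \<Sum>m\<in>multi_indices q N. a m * (character N m (x(j := y j)) - character N m x))"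
        unfolding sum_distrib_left by (rule sum.swap)
      finally show ?thesis
        by (simp add: char_sum_def sum_subtractf right_diff_distrib)
    qed
    ultimately show ?thesis by simp
  qed
  then have "(\<Sum>j<N. cmod (char_sum q N a (x(j := y j)) - char_sum q N a x)) \<le> 4 * (2 * real d * 2 ^ d * M)"
    by (intro sum_cmod_le_subset_sums) auto
  then show ?thesis by simp
qed

section \<open>Influences\<close>

text \<open>Rotating coordinate \<open>j\<close> by a fixed \<open>w\<close> permutes the cube, and
  \<open>x j * w\<close> runs through the group as \<open>w\<close> does.\<close>

lemma cube_avg_resample:
  assumes "q > 0" "j < N"
  shows "cube_avg q N g = (\<Sum>y\<in>cyc_group q. cube_avg q N (\<lambda>x. g (x(j := y)))) / real q"
proof -
  have rot: "(\<Sum>x\<in>cyc_cube q N. g (x(j := x j * w))) = (\<Sum>x\<in>cyc_cube q N. g x)"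
    if w: "w \<in> cyc_group q" for w
  proof -
    have w0: "w \<noteq> 0" using norm_cyc_group[OF assms(1) w] by auto
    have "inj_on (\<lambda>x. x(j := x j * w)) (cyc_cube q N)"
      using w0 by (intro inj_on_inverseI[where g = "\<lambda>z. z(j := z j / w)"]) auto
    moreover have "(\<lambda>x. x(j := x j * w)) ` cyc_cube q N \<subseteq> cyc_cube q N"
      by (rule image_subsetI, rule cyc_cube_upd) (use assms w in \<open>auto intro: mult_cyc_group cyc_cube_nth\<close>)
    ultimately have "bij_betw (\<lambda>x. x(j := x j * w)) (cyc_cube q N) (cyc_cube q N)"
      using endo_inj_surj finite_cyc_cube unfolding bij_betw_def by blast
    then show ?thesis
      by (rule sum.reindex_bij_betw)
  qed
  have "(\<Sum>y\<in>cyc_group q. \<Sum>x\<in>cyc_cube q N. g (x(j := y))) =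
      (\<Sum>x\<in>cyc_cube q N. \<Sum>y\<in>cyc_group q. g (x(j := y)))"
    by (rule sum.swap)
  also have "\<dots> = (\<Sum>x\<in>cyc_cube q N. \<Sum>w\<in>cyc_group q. g (x(j := x j * w)))"
  proof (rule sum.cong[OF refl])
    fix x assume "x \<in> cyc_cube q N"
    then have "x j \<in> cyc_group q" using assms(2) by (rule cyc_cube_nth)
    then show "(\<Sum>y\<in>cyc_group q. g (x(j := y))) = (\<Sum>w\<in>cyc_group q. g (x(j := x j * w)))"
      using sum_cyc_group_mult[OF assms(1), of "x j" "\<lambda>y. g (x(j := y))"] by simp
  qed
  also have "\<dots> = (\<Sum>w\<in>cyc_group q. \<Sum>x\<in>cyc_cube q N. g (x(j := x j * w)))"
    by (rule sum.swap)
  also have "\<dots> = real q * (\<Sum>x\<in>cyc_cube q N. g x)"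
    using rot assms(1) by (simp add: card_cyc_group)
  finally show ?thesis
    using assms(1) by (simp add: cube_avg_def flip: sum_divide_distrib)
qed

text \<open>The coefficients of a function minus its mean over coordinate \<open>j\<close>; see
  \<open>char_sum_deriv\<close>.\<close>

definition char_deriv :: "nat \<Rightarrow> ((nat \<Rightarrow> nat) \<Rightarrow> complex) \<Rightarrow> (nat \<Rightarrow> nat) \<Rightarrow> complex" where
  "char_deriv j a m = (if m j = 0 then 0 else a m)"

lemma char_sum_deriv:
  assumes "q > 0" "j < N"
  shows "char_sum q N (char_deriv j a) x =
    char_sum q N a x - (\<Sum>z\<in>cyc_group q. char_sum q N a (x(j := z))) / of_nat q"
proof -
  have "(\<Sum>z\<in>cyc_group q. character N m (x(j := z))) = (if m j = 0 then of_nat q * character N m x else 0)"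
    if m: "m \<in> multi_indices q N" for m
  proof -
    have "m j < q" using m assms(2) by (auto simp: multi_indices_def)
    then have "(\<Sum>z\<in>cyc_group q. z ^ m j) = (if m j = 0 then of_nat q else 0)"
      using sum_power_cyc_group[of "m j" q] assms(1) by (auto simp: card_cyc_group)
    moreover have "character N m x = (\<Prod>i\<in>{..<N} - {j}. x i ^ m i)" if "m j = 0"
      using character_upd_factor[OF assms(2), of m x "x j"] that by simp
    ultimately show ?thesis
      using assms(2) by (simp add: character_upd_factor flip: sum_distrib_right)
  qed
  then have "(\<Sum>z\<in>cyc_group q. char_sum q N a (x(j := z))) =
      (\<Sum>m\<in>multi_indices q N. a m * (if m j = 0 then of_nat q * character N m x else 0))"
    unfolding char_sum_def by (subst sum.swap) (simp flip: sum_distrib_left)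
  then have "char_sum q N a x - (\<Sum>z\<in>cyc_group q. char_sum q N a (x(j := z))) / of_nat q =
      (\<Sum>m\<in>multi_indices q N. a m * character N m x -
        a m * (if m j = 0 then of_nat q * character N m x else 0) / of_nat q)"
    by (simp add: char_sum_def sum_subtractf sum_divide_distrib)
  also have "\<dots> = char_sum q N (char_deriv j a) x"
    unfolding char_sum_def char_deriv_def using assms(1) by (intro sum.cong) auto
  finally show ?thesis ..
qed

text \<open>Every index that survives in \<open>char_deriv\<close> has \<open>j\<close> in its
  support. Freezing \<open>x j = y\<close> moves the power of \<open>y\<close> into the coefficients
  and removes \<open>j\<close> from the support, so the degree drops by one.\<close>

lemma char_sum_deriv_upd:
  assumes "deg_le q N (Suc d) a" "j < N" "q > 0"
  obtains b where "deg_le q N d b" "\<And>x. char_sum q N (char_deriv j a) (x(j := y)) = char_sum q N b x"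
proof -
  define b where "b m = (if m j = 0 then \<Sum>c\<in>{1..<q}. a (m(j := c)) * y ^ c else 0)" for m
  have upd: "m(j := c) \<in> multi_indices q N" if "m \<in> multi_indices q N" "c < q" for m c
    using that assms(2) unfolding multi_indices_def by (auto simp: PiE_def Pi_def extensional_def)
  have "deg_le q N d b"
    unfolding deg_le_def
  proof (intro ballI impI)
    fix m assume m: "m \<in> multi_indices q N" "b m \<noteq> 0"
    then have mj: "m j = 0" by (auto simp: b_def split: if_splits)
    with m have "(\<Sum>c\<in>{1..<q}. a (m(j := c)) * y ^ c) \<noteq> 0" by (simp add: b_def)
    then obtain c where c: "c \<in> {1..<q}" "a (m(j := c)) * y ^ c \<noteq> 0"
      by (rule sum.not_neutral_contains_not_neutral)
    then have "card (index_supp N (m(j := c))) \<le> Suc d"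
      using assms(1) upd[OF m(1)] by (auto simp: deg_le_def)
    moreover have "index_supp N (m(j := c)) = insert j (index_supp N m)" "j \<notin> index_supp N m"
      using c assms(2) mj by (auto simp: index_supp_def)
    ultimately show "card (index_supp N m) \<le> d" by simp
  qed
  moreover have "char_sum q N (char_deriv j a) (x(j := y)) = char_sum q N b x" for x
  proof -
    have "char_sum q N (char_deriv j a) (x(j := y)) =
        (\<Sum>m\<in>{m\<in>multi_indices q N. m j \<noteq> 0}. a m * character N m (x(j := y)))"
      unfolding char_sum_def by (intro sum.mono_neutral_cong_right) (auto simp: char_deriv_def)
    also have "\<dots> = (\<Sum>(m, c)\<in>{m\<in>multi_indices q N. m j = 0} \<times> {1..<q}.
        a (m(j := c)) * (y ^ c * character N m x))"
    \<comment> \<open>An index with \<open>m j \<noteq> 0\<close> is encoded as the pair of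
      \<open>m(j := 0)\<close> and its entry at \<open>j\<close>.\<close>
    proof (rule sum.reindex_bij_witness[of _ "\<lambda>(m, c). m(j := c)" "\<lambda>m. (m(j := 0), m j)"], goal_cases)
      case (2 m)
      then have "m j < q" using assms(2) by (auto simp: multi_indices_def)
      then show ?case using 2 upd assms(3) by auto
    next
      case (4 p)
      then show ?case using upd by (auto split: prod.splits)
    next
      case (5 m)
      have "character N (m(j := 0)) x = (\<Prod>i\<in>{..<N} - {j}. x i ^ m i)"
        using character_upd_factor[OF assms(2), of "m(j := 0)" x "x j"] by simp
      then show ?case
        using character_upd_factor[OF assms(2), of m x y] by simp
    qed auto
    also have "\<dots> = (\<Sum>m\<in>{m\<in>multi_indices q N. m j = 0}. \<Sum>c\<in>{1..<q}. a (m(j := c)) * (y ^ c * character N m x))"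
      by (simp add: sum.cartesian_product)
    also have "\<dots> = (\<Sum>m\<in>{m\<in>multi_indices q N. m j = 0}. b m * character N m x)"
      by (intro sum.cong refl) (simp add: b_def sum_distrib_right mult.assoc)
    also have "\<dots> = char_sum q N b x"
      unfolding char_sum_def by (intro sum.mono_neutral_left) (auto simp: b_def)
    finally show ?thesis .
  qed
  ultimately show thesis using that by blast
qed

lemma influence_bound:
  assumes "q > 0" "j < N" "deg_le q N (Suc d) a"
    and R: "\<And>x y. x \<in> cyc_cube q N \<Longrightarrow> y \<in> cyc_group q \<Longrightarrow>
      cmod (char_sum q N a (x(j := y)) - char_sum q N a x) \<le> R x"
  shows "sqrt (\<Sum>m\<in>{m\<in>multi_indices q N. m j \<noteq> 0}. (cmod (a m))\<^sup>2) \<le>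
    sqrt (16 * real q) ^ d * (2 * cube_avg q N R)"
proof (rule real_le_lsqrt)
  have R0: "0 \<le> R x" if "x \<in> cyc_cube q N" for x
    using R[OF that one_in_cyc_group[OF assms(1)]] norm_ge_zero order.trans by blast
  then show "0 \<le> sqrt (16 * real q) ^ d * (2 * cube_avg q N R)"
    by (simp add: cube_avg_nonneg)
  define F where "F = char_sum q N (char_deriv j a)"
  have F_le: "cmod (F (x(j := y))) \<le> 2 * R x" if x: "x \<in> cyc_cube q N" and y: "y \<in> cyc_group q" for x y
  proof -
    define f where "f = char_sum q N a"
    have "F (x(j := y)) = f (x(j := y)) - (\<Sum>z\<in>cyc_group q. f (x(j := z))) / of_nat q"
      unfolding F_def f_def char_sum_deriv[OF assms(1,2)] by simp
    \<comment> \<open>Inserting \<open>f x\<close> makes both terms changes from the base point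
      \<open>x\<close>, each at most \<open>R x\<close>; this is the factor 2.\<close>
    also have "\<dots> = (f (x(j := y)) - f x) - (\<Sum>z\<in>cyc_group q. f (x(j := z)) - f x) / of_nat q"
      using assms(1) by (simp add: sum_subtractf card_cyc_group diff_divide_distrib)
    finally have "cmod (F (x(j := y))) \<le> cmod (f (x(j := y)) - f x) +
        cmod (\<Sum>z\<in>cyc_group q. f (x(j := z)) - f x) / real q"
      using norm_triangle_ineq4[of "f (x(j := y)) - f x" "(\<Sum>z\<in>cyc_group q. f (x(j := z)) - f x) / of_nat q"]
      by (simp add: norm_divide)
    moreover have "cmod (\<Sum>z\<in>cyc_group q. f (x(j := z)) - f x) / real q \<le> R x"
    proof -
      have "cmod (\<Sum>z\<in>cyc_group q. f (x(j := z)) - f x) \<le> (\<Sum>z\<in>cyc_group q. R x)"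
        using R[OF x] unfolding f_def by (intro sum_norm_le) auto
      then show ?thesis
        using assms(1) by (simp add: card_cyc_group divide_le_eq mult.commute)
    qed
    moreover have "cmod (f (x(j := y)) - f x) \<le> R x"
      unfolding f_def using R x y .
    ultimately show ?thesis
      by linarith
  qed
  have "(\<Sum>m\<in>{m\<in>multi_indices q N. m j \<noteq> 0}. (cmod (a m))\<^sup>2) =
      (\<Sum>m\<in>multi_indices q N. (cmod (char_deriv j a m))\<^sup>2)"
    by (intro sum.mono_neutral_cong_left) (auto simp: char_deriv_def)
  also have "\<dots> = cube_avg q N (\<lambda>x. (cmod (F x))\<^sup>2)"
    unfolding F_def using cube_avg_char_sum_parseval[OF assms(1)] by simp
  also have "\<dots> = (\<Sum>y\<in>cyc_group q. cube_avg q N (\<lambda>x. (cmod (F (x(j := y))))\<^sup>2)) / real q"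
    by (rule cube_avg_resample[OF assms(1,2)])
  also have "\<dots> \<le> (\<Sum>y\<in>cyc_group q. (16 * real q) ^ d * (2 * cube_avg q N R)\<^sup>2) / real q"
  proof (intro divide_right_mono sum_mono)
    fix y assume y: "y \<in> cyc_group q"
    obtain b where b: "deg_le q N d b" "\<And>x. F (x(j := y)) = char_sum q N b x"
      using char_sum_deriv_upd[OF assms(3,2,1)] unfolding F_def by metis
    have "cube_avg q N (\<lambda>x. (cmod (F (x(j := y))))\<^sup>2) \<le>
        (16 * real q) ^ d * (cube_avg q N (\<lambda>x. cmod (F (x(j := y)))))\<^sup>2"
      unfolding b(2) using hypercontractive_2_1[OF assms(1) b(1)] .
    also have "\<dots> \<le> (16 * real q) ^ d * (2 * cube_avg q N R)\<^sup>2"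
      unfolding cube_avg_cmult[symmetric] using F_le y
      by (intro mult_left_mono power_mono cube_avg_mono cube_avg_nonneg) auto
    finally show "cube_avg q N (\<lambda>x. (cmod (F (x(j := y))))\<^sup>2) \<le> \<dots>" .
  qed simp
  also have "\<dots> = (sqrt (16 * real q) ^ d * (2 * cube_avg q N R))\<^sup>2"
  proof -
    have "(sqrt (16 * real q) ^ d)\<^sup>2 = (16 * real q) ^ d"
      by (metis mult.commute of_nat_0_le_iff power_mult real_sqrt_pow2 zero_le_mult_iff zero_le_numeral)
    then show ?thesis
      using assms(1) by (simp add: card_cyc_group power_mult_distrib)
  qed
  finally show "(\<Sum>m\<in>{m\<in>multi_indices q N. m j \<noteq> 0}. (cmod (a m))\<^sup>2) \<le>
      (sqrt (16 * real q) ^ d * (2 * cube_avg q N R))\<^sup>2" .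
qed

text \<open>Take for \<open>R j x\<close> the largest change that coordinate \<open>j\<close> can
  cause at \<open>x\<close>. The maximizing values for the different \<open>j\<close> are the
  coordinates of one point of the cube, so \<open>sum_single_changes_bound\<close> controls all of
  them at once.\<close>

lemma sum_influences_bound:
  assumes "q > 0" "deg_le q N (Suc d) a"
    and M: "\<And>x. x \<in> cyc_cube q N \<Longrightarrow> cmod (char_sum q N a x) \<le> M"
  shows "(\<Sum>j<N. sqrt (\<Sum>m\<in>{m\<in>multi_indices q N. m j \<noteq> 0}. (cmod (a m))\<^sup>2)) \<le>
    sqrt (16 * real q) ^ d * (16 * real (Suc d) * 2 ^ Suc d * M)"
proof -
  define V where "V = 8 * real (Suc d) * 2 ^ Suc d * M"
  define D where "D x j y = cmod (char_sum q N a (x(j := y)) - char_sum q N a x)" for x j y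
  define R where "R j x = Max (D x j ` cyc_group q)" for j x
  have ne: "cyc_group q \<noteq> {}" using one_in_cyc_group[OF assms(1)] by blast
  have "sqrt (\<Sum>m\<in>{m\<in>multi_indices q N. m j \<noteq> 0}. (cmod (a m))\<^sup>2) \<le>
      sqrt (16 * real q) ^ d * (2 * cube_avg q N (R j))" if "j < N" for j
  proof (rule influence_bound[OF assms(1) that assms(2)])
    fix x y assume "y \<in> cyc_group q"
    then show "cmod (char_sum q N a (x(j := y)) - char_sum q N a x) \<le> R j x"
      unfolding R_def D_def by (intro Max_ge) auto
  qed
  then have "(\<Sum>j<N. sqrt (\<Sum>m\<in>{m\<in>multi_indices q N. m j \<noteq> 0}. (cmod (a m))\<^sup>2)) \<le>
      (\<Sum>j<N. sqrt (16 * real q) ^ d * (2 * cube_avg q N (R j)))"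
    by (intro sum_mono) auto
  also have "\<dots> = sqrt (16 * real q) ^ d * (2 * cube_avg q N (\<lambda>x. \<Sum>j<N. R j x))"
    by (simp add: cube_avg_sum sum_distrib_left)
  also have "\<dots> \<le> sqrt (16 * real q) ^ d * (2 * V)"
  proof (intro mult_left_mono)
    have "cube_avg q N (\<lambda>x. \<Sum>j<N. R j x) \<le> cube_avg q N (\<lambda>x. V)"
    proof (rule cube_avg_mono)
      fix x assume x: "x \<in> cyc_cube q N"
      have "\<exists>y\<in>cyc_group q. R j x = D x j y" for j
      proof -
        have "R j x \<in> D x j ` cyc_group q"
          unfolding R_def using ne by (intro Max_in) auto
        then show ?thesis by blast
      qed
      then obtain y where y: "\<And>j. y j \<in> cyc_group q" "\<And>j. R j x = D x j (y j)" by metis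
      \<comment> \<open>The restriction makes the chosen values an extensional function, as points
        of the cube must be.\<close>
      have "(\<Sum>j<N. R j x) = (\<Sum>j<N. D x j (restrict y {..<N} j))"
        using y(2) by (intro sum.cong) auto
      also have "\<dots> \<le> V"
        unfolding D_def V_def using y(1) x
        by (intro sum_single_changes_bound[OF assms(1) _ assms(2) _ _ M]) (auto simp: cyc_cube_def)
      finally show "(\<Sum>j<N. R j x) \<le> V" .
    qed
    then show "cube_avg q N (\<lambda>x. \<Sum>j<N. R j x) \<le> V"
      using cube_avg_const[OF assms(1)] by simp
  qed auto
  finally show ?thesis
    by (simp add: V_def algebra_simps)
qed

section \<open>The Bohnenblust--Hille inequality\<close>

text \<open>Young's inequality with weights \<open>d / (d + 1)\<close> and
  \<open>1 / (d + 1)\<close>: in the weighted product \<open>v\<close> and \<open>c\<close> cancel.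
  The parameter \<open>c\<close> remains free for balancing powers of \<open>q\<close>.\<close>

lemma weighted_am_gm:
  fixes x v c d :: real
  assumes "x > 0" "v > 0" "c > 0" "d \<ge> 0"
  shows "x powr (2 * d / (d + 1)) \<le>
    d / (d + 1) * (c * x\<^sup>2 / v) + 1 / (d + 1) * (c powr - d * v powr d)"
proof -
  have eq: "d * (1 / (d + 1)) = d / (d + 1)" by simp
  have "(c * x\<^sup>2 / v) powr (d / (d + 1)) = c powr (d / (d + 1)) * x powr (2 * d / (d + 1)) / v powr (d / (d + 1))"
    using assms by (simp add: powr_mult powr_divide powr_powr flip: powr_numeral)
  moreover have "(c powr - d * v powr d) powr (1 / (d + 1)) = v powr (d / (d + 1)) / c powr (d / (d + 1))"
    using assms by (simp add: powr_mult powr_divide powr_powr powr_minus_divide)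
  ultimately have "x powr (2 * d / (d + 1)) = (c * x\<^sup>2 / v) powr (d / (d + 1)) * (c powr - d * v powr d) powr (1 / (d + 1))"
    using assms by simp
  also have "\<dots> \<le> d / (d + 1) * (c * x\<^sup>2 / v) + 1 / (d + 1) * (c powr - d * v powr d)"
    using assms by (intro Youngs_inequality_0) (auto simp: field_simps)
  finally show ?thesis .
qed

text \<open>The sum factorizes over the coordinates. Each factor is at most
  \<open>1 + w j \<le> exp (w j)\<close>, the \<open>q - 1\<close> nonzero entries being paid for by
  the division by \<open>q\<close>.\<close>

lemma sum_prod_supp_le:
  assumes "q \<ge> 1" "\<And>j. j < N \<Longrightarrow> 0 \<le> w j" "(\<Sum>j<N. w j) \<le> 1"
  shows "(\<Sum>m\<in>multi_indices q N. \<Prod>j<N. if m j = 0 then 1 else w j / real q) \<le> 3"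
proof -
  have "(\<Sum>m\<in>multi_indices q N. \<Prod>j<N. if m j = 0 then 1 else w j / real q) =
      (\<Prod>j<N. \<Sum>b<q. if b = 0 then 1 else w j / real q)"
    unfolding multi_indices_def by (subst prod_sum_PiE) auto
  also have "\<dots> \<le> (\<Prod>j<N. exp (w j))"
  proof (intro prod_mono conjI)
    fix j assume j: "j \<in> {..<N}"
    then show "0 \<le> (\<Sum>b<q. if b = 0 then 1 else w j / real q)"
      using assms(2) by (intro sum_nonneg) auto
    have "{..<q} = insert 0 {1..<q}" using assms(1) by auto
    then have "(\<Sum>b<q. if b = 0 then 1 else w j / real q) = 1 + real (q - 1) * (w j / real q)"
      by simp
    also have "real (q - 1) * (w j / real q) \<le> real q * (w j / real q)"
      using assms(2) j by (intro mult_right_mono) auto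
    also have "1 + real q * (w j / real q) \<le> exp (w j)"
      using assms(1) exp_ge_add_one_self[of "w j"] by simp
    finally show "(\<Sum>b<q. if b = 0 then 1 else w j / real q) \<le> exp (w j)" by simp
  qed
  also have "\<dots> = exp (\<Sum>j<N. w j)"
    by (simp add: exp_sum)
  also have "\<dots> \<le> exp 1"
    using assms(3) by simp
  finally show ?thesis
    using exp_le by linarith
qed

text \<open>
  The term of \<open>m\<close> is split by the weighted AM-GM inequality with \<open>v\<close> the least \<open>w j\<close> over the support
  of \<open>m\<close>: then \<open>1 / v\<close> is at most the sum of the \<open>1 / w j\<close>, and \<open>v ^ d\<close> is at most the product of the
  \<open>w j\<close>, because \<open>v \<le> 1\<close> and the support has at most \<open>d\<close> elements.
\<close>

lemma blei_normalized:
  fixes a :: "(nat \<Rightarrow> nat) \<Rightarrow> complex"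
  assumes "q \<ge> 1" "deg_le q N d a"
    and w0: "\<And>j. j < N \<Longrightarrow> 0 \<le> w j"
    and w2: "\<And>j. j < N \<Longrightarrow> (\<Sum>m\<in>{m\<in>multi_indices q N. m j \<noteq> 0}. (cmod (a m))\<^sup>2) \<le> (w j)\<^sup>2"
    and w1: "(\<Sum>j<N. w j) \<le> 1"
  shows "(\<Sum>m\<in>{m\<in>multi_indices q N. index_supp N m \<noteq> {}}. cmod (a m) powr (2 * real d / (real d + 1)))
    \<le> 3 * real q powr (real d / (real d + 1))"
proof -
  define \<theta> where "\<theta> = real d / (real d + 1)"
  \<comment> \<open>Chosen so that \<open>c powr - d * q ^ d = c\<close>; then both terms of the
    AM-GM bound carry the same factor \<open>c\<close>.\<close>
  define c where "c = real q powr \<theta>"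
  define g where "g m = (\<Prod>j<N. if m j = 0 then 1 else w j / real q)" for m :: "nat \<Rightarrow> nat"
  define h where "h m = (\<Sum>j<N. if m j = 0 then 0 else (cmod (a m))\<^sup>2 / w j)" for m
  have c0: "c > 0" using assms(1) by (simp add: c_def)
  have \<theta>: "0 \<le> \<theta>" "\<theta> \<le> 1" "1 / (real d + 1) = 1 - \<theta>"
    by (simp_all add: \<theta>_def field_simps)
  have g0: "0 \<le> g m" for m
    unfolding g_def using w0 by (intro prod_nonneg) auto
  have h0: "0 \<le> h m" for m
    unfolding h_def using w0 by (intro sum_nonneg) auto
  have ptw: "cmod (a m) powr (2 * real d / (real d + 1)) \<le> \<theta> * c * h m + (1 - \<theta>) * (c * g m)"
    if m: "m \<in> multi_indices q N" "index_supp N m \<noteq> {}" for m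
  proof (cases "a m = 0")
    case True
    then show ?thesis using g0 h0 \<theta> c0 by simp
  next
    case False
    define S where "S = index_supp N m"
    have cardS: "card S \<le> d"
      using assms(2) m(1) False by (simp add: deg_le_def S_def)
    have S: "finite S" "S \<noteq> {}" "S \<subseteq> {..<N}"
      using m(2) by (auto simp: S_def index_supp_def)
    have wpos: "w j > 0" if "j \<in> S" for j
    proof -
      have j: "j < N" "m j \<noteq> 0" using that by (auto simp: S_def index_supp_def)
      have "0 < (cmod (a m))\<^sup>2" using False by simp
      also have "\<dots> \<le> (\<Sum>m\<in>{m\<in>multi_indices q N. m j \<noteq> 0}. (cmod (a m))\<^sup>2)"
        using m(1) j by (intro member_le_sum) auto
      also have "\<dots> \<le> (w j)\<^sup>2" using w2 j by blast
      finally show ?thesis using w0[OF j(1)] by (simp add: less_le)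
    qed
    define v where "v = Min (w ` S)"
    have "v \<in> w ` S"
      unfolding v_def using S by (intro Min_in) auto
    then obtain i where i: "i \<in> S" "v = w i" by blast
    have vpos: "v > 0" using i wpos by simp
    have v_le: "v \<le> w j" if "j \<in> S" for j
      unfolding v_def using S that by simp
    have "w i \<le> (\<Sum>j<N. w j)"
      using i S w0 by (intro member_le_sum) auto
    then have v1: "v \<le> 1" using i w1 by simp
    have "(cmod (a m))\<^sup>2 / v \<le> h m"
    proof -
      have "(if m i = 0 then 0 else (cmod (a m))\<^sup>2 / w i) \<le> h m"
        unfolding h_def using i S w0
        by (intro member_le_sum[where f = "\<lambda>j. if m j = 0 then 0 else (cmod (a m))\<^sup>2 / w j"]) auto
      then show ?thesis using i by (simp add: S_def index_supp_def)
    qed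
    then have "\<theta> * c * ((cmod (a m))\<^sup>2 / v) \<le> \<theta> * c * h m"
      using \<theta> c0 by (intro mult_left_mono) auto
    moreover have "v ^ d \<le> real q ^ d * g m"
    proof -
      have "v ^ d \<le> v ^ card S"
        using vpos v1 cardS by (intro power_decreasing) auto
      also have "\<dots> \<le> (\<Prod>j\<in>S. w j)"
        using v_le vpos by (subst prod_constant[symmetric], intro prod_mono) auto
      also have "\<dots> = real q ^ card S * (\<Prod>j\<in>S. w j / real q)"
        using assms(1) by (simp add: prod_dividef)
      also have "\<dots> \<le> real q ^ d * (\<Prod>j\<in>S. w j / real q)"
        using assms(1) cardS wpos by (intro mult_right_mono power_increasing prod_nonneg) (auto simp: less_imp_le)
      also have "(\<Prod>j\<in>S. w j / real q) = g m"
        unfolding g_def using S by (intro prod.mono_neutral_cong_left) (auto simp: S_def index_supp_def)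
      finally show ?thesis .
    qed
    then have "(1 - \<theta>) * (c powr - real d * v ^ d) \<le> (1 - \<theta>) * (c powr - real d * (real q ^ d * g m))"
      using \<theta> by (intro mult_left_mono) auto
    moreover have "cmod (a m) powr (2 * real d / (real d + 1)) \<le>
        \<theta> * (c * (cmod (a m))\<^sup>2 / v) + (1 - \<theta>) * (c powr - real d * v ^ d)"
      using weighted_am_gm[of "cmod (a m)" v c "real d"] False vpos c0
      by (simp add: \<theta>(3) powr_realpow flip: \<theta>_def)
    moreover have cq: "c powr - real d * real q ^ d = c"
    proof -
      have "c powr - real d * real q ^ d = real q powr (- (\<theta> * real d) + real d)"
        unfolding powr_add using assms(1) by (simp add: c_def powr_powr powr_realpow)
      also have "- (\<theta> * real d) + real d = \<theta>"
        by (simp add: \<theta>_def field_simps)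
      finally show ?thesis by (simp add: c_def)
    qed
    ultimately show ?thesis
      by (simp add: mult.assoc[symmetric])
  qed
  have "(\<Sum>m\<in>{m\<in>multi_indices q N. index_supp N m \<noteq> {}}. cmod (a m) powr (2 * real d / (real d + 1))) \<le>
      (\<Sum>m\<in>{m\<in>multi_indices q N. index_supp N m \<noteq> {}}. \<theta> * c * h m + (1 - \<theta>) * (c * g m))"
    using ptw by (intro sum_mono) auto
  also have "\<dots> \<le> (\<Sum>m\<in>multi_indices q N. \<theta> * c * h m + (1 - \<theta>) * (c * g m))"
    using g0 h0 \<theta> c0 by (intro sum_mono2) auto
  also have "\<dots> = \<theta> * c * (\<Sum>m\<in>multi_indices q N. h m) + (1 - \<theta>) * (c * (\<Sum>m\<in>multi_indices q N. g m))"
    by (simp add: sum.distrib sum_distrib_left)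
  also have "\<dots> \<le> \<theta> * c * 1 + (1 - \<theta>) * (c * 3)"
  proof (intro add_mono mult_left_mono)
    show "(\<Sum>m\<in>multi_indices q N. g m) \<le> 3"
      unfolding g_def using assms(1) w0 w1 by (intro sum_prod_supp_le) auto
    have "(\<Sum>m\<in>multi_indices q N. h m) = (\<Sum>j<N. \<Sum>m\<in>multi_indices q N. if m j \<noteq> 0 then (cmod (a m))\<^sup>2 / w j else 0)"
      unfolding h_def by (subst sum.swap) (intro sum.cong, auto)
    also have "\<dots> = (\<Sum>j<N. (\<Sum>m\<in>{m\<in>multi_indices q N. m j \<noteq> 0}. (cmod (a m))\<^sup>2) / w j)"
      unfolding sum_divide_distrib
      by (rule sum.cong[OF refl], rule sum.inter_filter[symmetric]) simp
    also have "\<dots> \<le> (\<Sum>j<N. w j)"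
    proof (rule sum_mono)
      fix j assume j: "j \<in> {..<N}"
      then have "(\<Sum>m\<in>{m\<in>multi_indices q N. m j \<noteq> 0}. (cmod (a m))\<^sup>2) / w j \<le> (w j)\<^sup>2 / w j"
        using w0 w2 by (intro divide_right_mono) auto
      \<comment> \<open>This covers \<open>w j = 0\<close> as well, where division gives 0.\<close>
      then show "(\<Sum>m\<in>{m\<in>multi_indices q N. m j \<noteq> 0}. (cmod (a m))\<^sup>2) / w j \<le> w j"
        by (simp add: power2_eq_square)
    qed
    finally show "(\<Sum>m\<in>multi_indices q N. h m) \<le> 1"
      using w1 by simp
  qed (use \<theta> c0 in auto)
  also have "\<dots> \<le> 3 * c"
    using \<theta> c0 by (simp add: algebra_simps)
  finally show ?thesis
    unfolding c_def \<theta>_def .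
qed

section \<open>The constant coefficient and the full inequality\<close>

lemma norm_coeff_le:
  assumes "q > 0" "\<And>x. x \<in> cyc_cube q N \<Longrightarrow> cmod (char_sum q N a x) \<le> M" "m \<in> multi_indices q N"
  shows "cmod (a m) \<le> M"
proof -
  have M0: "0 \<le> M"
  proof -
    obtain x where "x \<in> cyc_cube q N" using cyc_cube_nonempty[OF assms(1)] by blast
    then show ?thesis using assms(2)[of x] norm_ge_zero order.trans by blast
  qed
  have "(cmod (a m))\<^sup>2 \<le> (\<Sum>m\<in>multi_indices q N. (cmod (a m))\<^sup>2)"
    using assms(3) by (intro member_le_sum) auto
  also have "\<dots> = cube_avg q N (\<lambda>x. (cmod (char_sum q N a x))\<^sup>2)"
    using cube_avg_char_sum_parseval[OF assms(1)] by simp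
  also have "\<dots> \<le> cube_avg q N (\<lambda>x. M\<^sup>2)"
    using assms(2) by (intro cube_avg_mono power_mono) auto
  also have "\<dots> = M\<^sup>2"
    using cube_avg_const[OF assms(1)] .
  finally show ?thesis
    using M0 power2_le_imp_le by blast
qed

text \<open>Dividing by the bound \<open>W\<close> on the sum of the influences normalizes the
  coefficients for \<open>blei_normalized\<close>. Since \<open>\<theta> / p = 1 / 2\<close>, the
  factor \<open>q powr \<theta>\<close> in the sum of \<open>p\<close>-th powers becomes
  \<open>sqrt q\<close> in the norm.\<close>

lemma bohnenblust_hille:
  assumes "q > 0" "deg_le q N (Suc k) a" "M > 0"
    and M: "\<And>x. x \<in> cyc_cube q N \<Longrightarrow> cmod (char_sum q N a x) \<le> M"
    and d: "d = Suc k"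
  shows "(\<Sum>m\<in>multi_indices q N. cmod (a m) powr (2 * real d / (real d + 1))) powr ((real d + 1) / (2 * real d))
    \<le> (256 * sqrt (real q)) ^ d * M"
proof -
  define p where "p = 2 * real d / (real d + 1)"
  define \<theta> where "\<theta> = real d / (real d + 1)"
  define W where "W = sqrt (16 * real q) ^ k * (16 * real d * 2 ^ d * M)"
  have p: "p \<ge> 1" "p = 2 * \<theta>" "(real d + 1) / (2 * real d) = 1 / p"
    unfolding p_def \<theta>_def d by (simp_all add: field_simps)
  have q1: "1 \<le> real q" using assms(1) by simp
  \<comment> \<open>Needed for the constant coefficient, which no influence sees and which is
    bounded by \<open>M\<close> instead.\<close>
  have "M \<le> W"
  proof -
    have "1 * (1 * 1) \<le> sqrt (16 * real q) ^ k * (16 * real d * 2 ^ d)"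
      using q1 d by (intro mult_mono one_le_power) auto
    then show ?thesis
      using assms(3) mult_right_mono[of 1 "sqrt (16 * real q) ^ k * (16 * real d * 2 ^ d)" M]
      by (simp add: W_def mult.assoc)
  qed
  then have Wpos: "W > 0" using assms(3) by linarith
  define b where "b m = a m / of_real W" for m
  have norm_b: "cmod (b m) = cmod (a m) / W" for m
    using Wpos by (simp add: b_def norm_divide)
  define w where "w j = sqrt (\<Sum>m\<in>{m\<in>multi_indices q N. m j \<noteq> 0}. (cmod (b m))\<^sup>2)" for j
  have w: "w j = sqrt (\<Sum>m\<in>{m\<in>multi_indices q N. m j \<noteq> 0}. (cmod (a m))\<^sup>2) / W" for j
    using Wpos by (simp add: w_def norm_b power_divide real_sqrt_divide flip: sum_divide_distrib)
  have "(\<Sum>j<N. w j) = (\<Sum>j<N. sqrt (\<Sum>m\<in>{m\<in>multi_indices q N. m j \<noteq> 0}. (cmod (a m))\<^sup>2)) / W"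
    unfolding w by (simp add: sum_divide_distrib)
  also have "\<dots> \<le> 1"
    using sum_influences_bound[OF assms(1,2) M] Wpos by (simp add: W_def d divide_le_eq)
  finally have w1: "(\<Sum>j<N. w j) \<le> 1" .
  have "deg_le q N d b"
    using assms(2) by (auto simp: deg_le_def b_def d)
  then have nonzero: "(\<Sum>m\<in>{m\<in>multi_indices q N. index_supp N m \<noteq> {}}. cmod (b m) powr p) \<le> 3 * real q powr \<theta>"
    unfolding p_def \<theta>_def using assms(1) w1
    by (intro blei_normalized[where w = w]) (auto simp: w_def sum_nonneg)
  have zero: "(\<Sum>m\<in>{m\<in>multi_indices q N. index_supp N m = {}}. cmod (b m) powr p) \<le> 1 * real q powr \<theta>"
  proof -
    have "m = (\<lambda>j\<in>{..<N}. 0)" if "m \<in> multi_indices q N" "index_supp N m = {}" for m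
    proof
      fix j show "m j = (\<lambda>j\<in>{..<N}. 0) j"
        using that by (cases "j < N") (auto simp: multi_indices_def index_supp_def PiE_def extensional_def)
    qed
    then have "{m\<in>multi_indices q N. index_supp N m = {}} \<subseteq> {\<lambda>j\<in>{..<N}. 0}" by blast
    then have "card {m\<in>multi_indices q N. index_supp N m = {}} \<le> 1"
      using card_mono[of "{\<lambda>j\<in>{..<N}. 0::nat}"] by fastforce
    moreover have "cmod (b m) powr p \<le> 1" if "m \<in> multi_indices q N" for m
    proof -
      have "cmod (b m) \<le> 1"
        using norm_coeff_le[OF assms(1) M that] \<open>M \<le> W\<close> Wpos by (simp add: norm_b divide_le_eq)
      then show ?thesis
        using p by (intro powr_le1) auto
    qed
    then have "(\<Sum>m\<in>{m\<in>multi_indices q N. index_supp N m = {}}. cmod (b m) powr p) \<le>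
        real (card {m\<in>multi_indices q N. index_supp N m = {}}) * 1"
      by (intro sum_bounded_above) auto
    ultimately have "(\<Sum>m\<in>{m\<in>multi_indices q N. index_supp N m = {}}. cmod (b m) powr p) \<le> 1"
      by linarith
    also have "1 \<le> real q powr \<theta>"
      using q1 by (intro ge_one_powr_ge_zero) (auto simp: \<theta>_def)
    finally show ?thesis by simp
  qed
  have "(\<Sum>m\<in>multi_indices q N. cmod (b m) powr p) =
      (\<Sum>m\<in>{m\<in>multi_indices q N. index_supp N m \<noteq> {}}. cmod (b m) powr p) +
      (\<Sum>m\<in>{m\<in>multi_indices q N. index_supp N m = {}}. cmod (b m) powr p)"
    by (subst sum.union_disjoint[symmetric]) (auto intro!: sum.cong)
  then have total: "(\<Sum>m\<in>multi_indices q N. cmod (b m) powr p) \<le> 4 * real q powr \<theta>"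
    using nonzero zero by linarith
  have "(\<Sum>m\<in>multi_indices q N. cmod (a m) powr p) = W powr p * (\<Sum>m\<in>multi_indices q N. cmod (b m) powr p)"
    using Wpos by (simp add: norm_b powr_divide sum_distrib_left)
  then have "(\<Sum>m\<in>multi_indices q N. cmod (a m) powr p) powr (1 / p) =
      W * (\<Sum>m\<in>multi_indices q N. cmod (b m) powr p) powr (1 / p)"
    using Wpos p by (simp add: powr_mult powr_powr sum_nonneg)
  also have "\<dots> \<le> W * (4 * real q powr \<theta>) powr (1 / p)"
    using total p Wpos by (intro mult_left_mono powr_mono2 sum_nonneg) auto
  also have "(4 * real q powr \<theta>) powr (1 / p) = 4 powr (1 / p) * sqrt (real q)"
    using p by (simp add: powr_mult powr_powr powr_half_sqrt)
  also have "W * \<dots> \<le> W * (4 powr 1 * sqrt (real q))"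
    using p Wpos by (intro mult_left_mono mult_right_mono powr_mono) auto
  also have "\<dots> = (4 * sqrt (real q)) ^ d * 16 * (real d * 2 ^ d) * M"
    by (simp add: W_def d real_sqrt_mult)
  \<comment> \<open>Every factor is raised to the power \<open>d\<close>, by
    \<open>16 \<le> 16 ^ d\<close> and \<open>d \<le> 2 ^ d\<close>; the base is then
    \<open>4 * 16 * 4 = 256\<close> times \<open>sqrt q\<close>.\<close>
  also have "\<dots> \<le> (4 * sqrt (real q)) ^ d * 16 ^ d * (2 ^ d * 2 ^ d) * M"
  proof -
    have "real d \<le> 2 ^ d" using less_exp[of d] by (simp add: less_imp_le of_nat_less_numeral_power_cancel_iff)
    moreover have "(16::real) ^ 1 \<le> 16 ^ d" using d by (intro power_increasing) auto
    ultimately show ?thesis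
      using assms(3) by (intro mult_right_mono mult_mono) auto
  qed
  also have "\<dots> = (256 * sqrt (real q)) ^ d * M"
  proof -
    have "(4 * sqrt (real q)) ^ d * 16 ^ d * (2 ^ d * 2 ^ d) = (4 * sqrt (real q) * 16 * (2 * 2)) ^ d"
      by (simp only: power_mult_distrib)
    then show ?thesis by simp
  qed
  finally show ?thesis
    unfolding p(3) p_def[symmetric] .
qed

section \<open>Optimality of the exponent\<close>

lemma discrete_fourier_parseval:
  assumes "n > 0"
  shows "(\<Sum>l<n. (cmod (\<Sum>k<n. c k * (root_of_unity_gen n ^ l) ^ k))\<^sup>2) = real n * (\<Sum>k<n. (cmod (c k))\<^sup>2)"
proof -
  have img: "cyc_group n = (\<lambda>l. root_of_unity_gen n ^ l) ` {..<n}"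
    by (auto simp: cyc_group_def)
  have "inj_on (\<lambda>l. root_of_unity_gen n ^ l) {..<n}"
    using card_cyc_group[OF assms] unfolding img by (intro eq_card_imp_inj_on) auto
  then have "(\<Sum>l<n. (cmod (\<Sum>k<n. c k * (root_of_unity_gen n ^ l) ^ k))\<^sup>2) =
      (\<Sum>z\<in>cyc_group n. (cmod (\<Sum>k<n. c k * z ^ k))\<^sup>2)"
    unfolding img by (simp add: sum.reindex)
  also have "\<dots> = real n * (\<Sum>k<n. (cmod (c k))\<^sup>2)"
    by (rule orthogonal_parseval) (auto simp: sum_power_cnj_cyc_group simp del: complex_cnj_power)
  finally show ?thesis .
qed

text \<open>
  The product of the Fourier matrix entries at \<open>(i 0, i 1)\<close>, \<open>(i 1, i 2)\<close>, \<open>\<dots>\<close>, \<open>(i (k - 1), l)\<close>.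
\<close>

definition fourier_chain :: "nat \<Rightarrow> nat \<Rightarrow> nat \<Rightarrow> (nat \<Rightarrow> nat) \<Rightarrow> complex" where
  "fourier_chain n k l i = (\<Prod>r<k. (root_of_unity_gen n ^ (i(k := l)) (Suc r)) ^ i r)"

lemma fourier_chain_Suc:
  "fourier_chain n (Suc k) l (i(k := c)) = fourier_chain n k c i * (root_of_unity_gen n ^ l) ^ c"
proof -
  have "fourier_chain n (Suc k) l (i(k := c)) =
      (\<Prod>r<k. (root_of_unity_gen n ^ ((i(k := c))(Suc k := l)) (Suc r)) ^ (i(k := c)) r) *
      (root_of_unity_gen n ^ l) ^ c"
    by (simp add: fourier_chain_def)
  also have "(\<Prod>r<k. (root_of_unity_gen n ^ ((i(k := c))(Suc k := l)) (Suc r)) ^ (i(k := c)) r) =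
      fourier_chain n k c i"
    unfolding fourier_chain_def by (intro prod.cong) auto
  finally show ?thesis .
qed

lemma norm_root_of_unity_gen: "cmod (root_of_unity_gen n) = 1"
  by (simp add: root_of_unity_gen_def norm_exp_eq_Re)

lemma norm_fourier_chain: "cmod (fourier_chain n k l i) = 1"
  by (simp add: fourier_chain_def prod_norm[symmetric] norm_power norm_root_of_unity_gen)

text \<open>Keeping the last index \<open>l\<close> free makes an induction possible: multiplying by
  the variables of a new block does not increase the Euclidean norm, and the next Fourier matrix
  multiplies its square by exactly \<open>n\<close>.\<close>

lemma fourier_chain_form_bound:
  assumes "n > 0" "\<And>r l. r < k \<Longrightarrow> l < n \<Longrightarrow> cmod (u r l) \<le> 1"
  shows "(\<Sum>l<n. (cmod (\<Sum>i\<in>{..<k} \<rightarrow>\<^sub>E {..<n}. fourier_chain n k l i * (\<Prod>r<k. u r (i r))))\<^sup>2)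
    \<le> real n ^ Suc k"
  using assms(2)
proof (induction k)
  case 0
  show ?case by (simp add: fourier_chain_def)
next
  case (Suc k)
  define V where "V l = (\<Sum>i\<in>{..<k} \<rightarrow>\<^sub>E {..<n}. fourier_chain n k l i * (\<Prod>r<k. u r (i r)))" for l
  have V: "(\<Sum>i\<in>{..<Suc k} \<rightarrow>\<^sub>E {..<n}. fourier_chain n (Suc k) l i * (\<Prod>r<Suc k. u r (i r))) =
      (\<Sum>c<n. (u k c * V c) * (root_of_unity_gen n ^ l) ^ c)" for l
    unfolding sum_PiE_Suc fourier_chain_Suc V_def sum_distrib_left sum_distrib_right
    by (intro sum.cong refl) (simp add: mult_ac)
  have "(\<Sum>l<n. (cmod (\<Sum>c<n. (u k c * V c) * (root_of_unity_gen n ^ l) ^ c))\<^sup>2) =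
      real n * (\<Sum>c<n. (cmod (u k c * V c))\<^sup>2)"
    using assms(1) by (rule discrete_fourier_parseval)
  also have "\<dots> \<le> real n * (\<Sum>c<n. (cmod (V c))\<^sup>2)"
  proof (intro mult_left_mono sum_mono power_mono)
    fix c assume "c \<in> {..<n}"
    then show "cmod (u k c * V c) \<le> cmod (V c)"
      using Suc.prems[of k c] by (simp add: norm_mult mult_left_le_one_le)
  qed auto
  also have "\<dots> \<le> real n * real n ^ Suc k"
    using Suc.IH Suc.prems unfolding V_def by (intro mult_left_mono) auto
  finally show ?case
    unfolding V by simp
qed

text \<open>
  Variable \<open>l\<close> of block \<open>r\<close> is coordinate \<open>r * n + l\<close>.
\<close>

definition block_index :: "nat \<Rightarrow> nat \<Rightarrow> (nat \<Rightarrow> nat) \<Rightarrow> nat \<Rightarrow> nat" where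
  "block_index n d i = (\<lambda>j\<in>{..<d * n}. if j mod n = i (j div n) then 1 else 0)"

lemma block_less: "r < d \<Longrightarrow> l < n \<Longrightarrow> r * n + l < d * (n::nat)"
proof -
  assume "r < d" "l < n"
  then have "r * n + l < Suc r * n" by simp
  also have "\<dots> \<le> d * n" using \<open>r < d\<close> by (intro mult_right_mono) auto
  finally show ?thesis .
qed

section \<open>Block indices and the extremal function\<close>

lemma index_supp_block_index:
  assumes "i \<in> {..<d} \<rightarrow>\<^sub>E {..<n}"
  shows "index_supp (d * n) (block_index n d i) = (\<lambda>r. r * n + i r) ` {..<d}"
proof
  show "index_supp (d * n) (block_index n d i) \<subseteq> (\<lambda>r. r * n + i r) ` {..<d}"
  proof
    fix j assume "j \<in> index_supp (d * n) (block_index n d i)"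
    then have j: "j < d * n" "j mod n = i (j div n)"
      by (auto simp: index_supp_def block_index_def split: if_splits)
    then have "j div n < d" "j = (j div n) * n + i (j div n)"
      by (simp_all add: less_mult_imp_div_less flip: j(2))
    then show "j \<in> (\<lambda>r. r * n + i r) ` {..<d}" by blast
  qed
  show "(\<lambda>r. r * n + i r) ` {..<d} \<subseteq> index_supp (d * n) (block_index n d i)"
  proof
    fix j assume "j \<in> (\<lambda>r. r * n + i r) ` {..<d}"
    then obtain r where r: "r < d" "j = r * n + i r" by blast
    then have "i r < n" using assms by auto
    then have "j < d * n" "j mod n = i (j div n)"
      using r block_less[of r d "i r" n] by simp_all
    then show "j \<in> index_supp (d * n) (block_index n d i)"
      by (simp add: index_supp_def block_index_def)
  qed
qed

lemma inj_on_block: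
  assumes "i \<in> {..<d} \<rightarrow>\<^sub>E {..<n::nat}"
  shows "inj_on (\<lambda>r. r * n + i r) {..<d}"
proof (rule inj_on_inverseI)
  fix r assume "r \<in> {..<d}"
  then have "i r < n" using assms by auto
  then show "(r * n + i r) div n = r" by simp
qed

lemma character_block_index:
  assumes "i \<in> {..<d} \<rightarrow>\<^sub>E {..<n}"
  shows "character (d * n) (block_index n d i) x = (\<Prod>r<d. x (r * n + i r))"
proof -
  have "character (d * n) (block_index n d i) x =
      (\<Prod>j\<in>index_supp (d * n) (block_index n d i). x j ^ block_index n d i j)"
    unfolding character_def by (intro prod.mono_neutral_right) (auto simp: index_supp_def)
  also have "\<dots> = (\<Prod>j\<in>index_supp (d * n) (block_index n d i). x j)"
    by (intro prod.cong) (auto simp: index_supp_def block_index_def)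
  finally show ?thesis
    unfolding index_supp_block_index[OF assms] using inj_on_block[OF assms] by (simp add: prod.reindex)
qed

lemma inj_on_block_index: "inj_on (block_index n d) ({..<d} \<rightarrow>\<^sub>E {..<n})"
proof (rule inj_onI)
  fix i k assume ik: "i \<in> {..<d} \<rightarrow>\<^sub>E {..<n}" "k \<in> {..<d} \<rightarrow>\<^sub>E {..<n}"
    and eq: "block_index n d i = block_index n d k"
  show "i = k"
  proof (rule PiE_ext[OF ik])
    fix r assume "r \<in> {..<d}"
    then have r: "r < d" "i r < n" using ik by auto
    then have "r * n + i r \<in> index_supp (d * n) (block_index n d k)"
      using index_supp_block_index[OF ik(1)] eq by auto
    then show "i r = k r"
      using r by (auto simp: index_supp_def block_index_def split: if_splits)
  qed
qed

lemma block_index_low: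
  assumes "i \<in> {..<d} \<rightarrow>\<^sub>E {..<n}" "q \<ge> 2"
  shows "block_index n d i \<in> low_indices q (d * n) d"
proof -
  have "card (index_supp (d * n) (block_index n d i)) = d"
    unfolding index_supp_block_index[OF assms(1)] using inj_on_block[OF assms(1)] by (simp add: card_image)
  then show ?thesis
    using assms(2) by (auto simp: low_indices_def multi_indices_def block_index_def)
qed

text \<open>The chain is closed with \<open>l = 0\<close>. Its coefficients have modulus 1, so a
  single function serves all \<open>p\<close>.\<close>

lemma extremal_form:
  assumes "q \<ge> 2" "n > 0"
  shows "\<exists>f\<in>low_degree q (d * n) d. sup_norm q (d * n) f \<le> sqrt (real n ^ Suc d) \<and>
    (\<forall>p. real n ^ d \<le> (\<Sum>m\<in>low_indices q (d * n) d. cmod (fourier_coeff q (d * n) f m) powr p))"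
proof -
  define T where "T = {..<d} \<rightarrow>\<^sub>E {..<n}"
  define N where "N = d * n"
  have finT [simp]: "finite T" unfolding T_def by (simp add: finite_PiE)
  define a where "a m = (\<Sum>i\<in>T. if m = block_index n d i then fourier_chain n d 0 i else 0)" for m
  have a_block: "a (block_index n d k) = fourier_chain n d 0 k" if "k \<in> T" for k
  proof -
    have "a (block_index n d k) = (\<Sum>i\<in>T. if k = i then fourier_chain n d 0 i else 0)"
      unfolding a_def using inj_on_block_index[of n d] that
      by (intro sum.cong) (auto simp: T_def dest: inj_onD)
    then show ?thesis using that by simp
  qed
  have low: "block_index n d i \<in> low_indices q N d" if "i \<in> T" for i
    using block_index_low assms(1) that unfolding T_def N_def by blast
  have deg: "deg_le q N d a"
    unfolding deg_le_def
  proof (intro ballI impI)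
    fix m assume "a m \<noteq> 0"
    then obtain i where "i \<in> T" "m = block_index n d i"
      unfolding a_def by (rule sum.not_neutral_contains_not_neutral) (auto split: if_splits)
    then show "card (index_supp N m) \<le> d"
      using low by (auto simp: low_indices_def)
  qed
  have "char_sum q N a x = (\<Sum>i\<in>T. fourier_chain n d 0 i * (\<Prod>r<d. x (r * n + i r)))" for x
  proof -
    have "char_sum q N a x = (\<Sum>i\<in>T. \<Sum>m\<in>multi_indices q N.
        if m = block_index n d i then fourier_chain n d 0 i * character N m x else 0)"
      unfolding char_sum_def a_def sum_distrib_right
      by (subst sum.swap) (intro sum.cong refl, auto)
    also have "\<dots> = (\<Sum>i\<in>T. fourier_chain n d 0 i * character N (block_index n d i) x)"
      using subsetD[OF low_indices_subset low] by (intro sum.cong refl) simp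
    finally show ?thesis
      using character_block_index unfolding T_def N_def by simp
  qed
  note form = this
  have "cmod (char_sum q N a x) \<le> sqrt (real n ^ Suc d)" if x: "x \<in> cyc_cube q N" for x
  proof (rule real_le_rsqrt)
    \<comment> \<open>The form is the term \<open>l = 0\<close> of the sum estimated in
      \<open>fourier_chain_form_bound\<close>.\<close>
    have "(cmod (char_sum q N a x))\<^sup>2 \<le>
        (\<Sum>l<n. (cmod (\<Sum>i\<in>T. fourier_chain n d l i * (\<Prod>r<d. x (r * n + i r))))\<^sup>2)"
      unfolding form using assms(2)
      by (intro member_le_sum[where f = "\<lambda>l. (cmod (\<Sum>i\<in>T. fourier_chain n d l i * (\<Prod>r<d. x (r * n + i r))))\<^sup>2"]) auto
    also have "\<dots> \<le> real n ^ Suc d"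
      unfolding T_def
    proof (rule fourier_chain_form_bound[where u = "\<lambda>r l. x (r * n + l)"])
      fix r l assume "r < d" "l < n"
      then have "x (r * n + l) \<in> cyc_group q"
        using x block_less cyc_cube_nth unfolding N_def by blast
      then show "cmod (x (r * n + l)) \<le> 1"
        using norm_cyc_group[of q "x (r * n + l)"] assms(1) by simp
    qed (use assms in auto)
    finally show "(cmod (char_sum q N a x))\<^sup>2 \<le> real n ^ Suc d" .
  qed
  then have sup: "sup_norm q N (char_sum q N a) \<le> sqrt (real n ^ Suc d)"
    using assms(1) by (intro sup_norm_le) auto
  have "real n ^ d \<le> (\<Sum>m\<in>low_indices q N d. cmod (fourier_coeff q N (char_sum q N a) m) powr p)" for p
  proof -
    have "real n ^ d = real (card T)"
      unfolding T_def by (simp add: card_PiE)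
    also have "\<dots> = (\<Sum>i\<in>T. cmod (fourier_coeff q N (char_sum q N a) (block_index n d i)) powr p)"
    proof -
      have "fourier_coeff q N (char_sum q N a) (block_index n d i) = fourier_chain n d 0 i" if "i \<in> T" for i
        using fourier_coeff_char_sum[of q N "char_sum q N a" a] low[OF that] low_indices_subset a_block[OF that] assms(1)
        by (metis (no_types, lifting) gr0I not_numeral_le_zero subsetD)
      then show ?thesis by (simp add: norm_fourier_chain)
    qed
    also have "\<dots> = (\<Sum>m\<in>block_index n d ` T. cmod (fourier_coeff q N (char_sum q N a) m) powr p)"
      using inj_on_block_index by (subst sum.reindex) (auto simp: T_def)
    also have "\<dots> \<le> (\<Sum>m\<in>low_indices q N d. cmod (fourier_coeff q N (char_sum q N a) m) powr p)"
      using low by (intro sum_mono2) auto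
    finally show ?thesis .
  qed
  moreover have "char_sum q N a \<in> low_degree q N d"
    using deg low_degree_iff by blast
  ultimately show ?thesis
    using sup unfolding N_def by blast
qed

lemma exponent_optimal:
  assumes "q \<ge> 2" "d \<ge> 1" "0 < p" "p < 2 * real d / (real d + 1)"
  shows "\<not> (\<exists>C :: real. \<forall>N \<ge> 1. \<forall>f \<in> low_degree q N d.
    (\<Sum>m\<in>low_indices q N d. cmod (fourier_coeff q N f m) powr p) powr (1 / p) \<le> C * sup_norm q N f)"
proof
  assume "\<exists>C :: real. \<forall>N \<ge> 1. \<forall>f \<in> low_degree q N d.
    (\<Sum>m\<in>low_indices q N d. cmod (fourier_coeff q N f m) powr p) powr (1 / p) \<le> C * sup_norm q N f"
  then obtain C where C: "\<And>N f. N \<ge> 1 \<Longrightarrow> f \<in> low_degree q N d \<Longrightarrow>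
    (\<Sum>m\<in>low_indices q N d. cmod (fourier_coeff q N f m) powr p) powr (1 / p) \<le> C * sup_norm q N f"
    by blast
  \<comment> \<open>The left side grows at least like \<open>n powr (d / p)\<close>, the sup norm at
    most like \<open>n powr ((d + 1) / 2)\<close>; the gap \<open>e\<close> is positive exactly
    below the critical exponent.\<close>
  define e where "e = real d / p - (real d + 1) / 2"
  have "e > 0"
    using assms by (simp add: e_def field_simps)
  have bound: "real n powr e \<le> \<bar>C\<bar>" if n: "n > 0" for n
  proof -
    obtain f where f: "f \<in> low_degree q (d * n) d" "sup_norm q (d * n) f \<le> sqrt (real n ^ Suc d)"
      "\<And>p. real n ^ d \<le> (\<Sum>m\<in>low_indices q (d * n) d. cmod (fourier_coeff q (d * n) f m) powr p)"
      using extremal_form[OF assms(1) n, of d] by blast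
    have "real n ^ d = real n powr real d"
      using n by (simp add: powr_realpow)
    then have "real n powr (real d / p) = (real n ^ d) powr (1 / p)"
      by (simp add: powr_powr)
    also have "\<dots> \<le> (\<Sum>m\<in>low_indices q (d * n) d. cmod (fourier_coeff q (d * n) f m) powr p) powr (1 / p)"
      using assms f(3) by (intro powr_mono2) auto
    also have "\<dots> \<le> C * sup_norm q (d * n) f"
      using C[OF _ f(1)] n assms(2) by simp
    \<comment> \<open>The sign of \<open>C\<close> is unknown, and an upper bound on the norm can
      only be inserted after a nonnegative factor.\<close>
    also have "\<dots> \<le> \<bar>C\<bar> * sup_norm q (d * n) f"
    proof (rule mult_right_mono)
      obtain x where "x \<in> cyc_cube q (d * n)"
        using cyc_cube_nonempty[of q] assms(1) by fastforce
      then show "0 \<le> sup_norm q (d * n) f"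
        using norm_le_sup_norm norm_ge_zero order.trans by blast
    qed simp
    also have "\<dots> \<le> \<bar>C\<bar> * sqrt (real n ^ Suc d)"
      using f(2) by (intro mult_left_mono) auto
    also have "sqrt (real n ^ Suc d) = real n powr ((real d + 1) / 2)"
    proof -
      have "sqrt (real n ^ Suc d) = (real n ^ Suc d) powr (1 / 2)"
        by (simp add: powr_half_sqrt del: power_Suc)
      also have "\<dots> = (real n powr real (Suc d)) powr (1 / 2)"
        using n powr_realpow[of "real n" "Suc d"] by (simp del: power_Suc)
      also have "\<dots> = real n powr ((real d + 1) / 2)"
        unfolding powr_powr by (simp add: add.commute)
      finally show ?thesis .
    qed
    finally have "real n powr (real d / p) / real n powr ((real d + 1) / 2) \<le> \<bar>C\<bar>"
      using n by (simp add: divide_le_eq)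
    then show ?thesis
      by (simp add: e_def powr_diff)
  qed
  obtain n where n: "(\<bar>C\<bar> + 1) powr (1 / e) < real n"
    using reals_Archimedean2 by blast
  then have "n > 0"
    by (metis gr0I linorder_not_less of_nat_0 powr_ge_zero)
  have "\<bar>C\<bar> + 1 = ((\<bar>C\<bar> + 1) powr (1 / e)) powr e"
    unfolding powr_powr using \<open>e > 0\<close> by simp
  also have "\<dots> \<le> real n powr e"
    using n \<open>e > 0\<close> by (intro powr_mono2) auto
  finally show False
    using bound[OF \<open>n > 0\<close>] by simp
qed

theorem theorem2p13:
  shows
    "(\<exists>D1 :: nat \<Rightarrow> real.
        (\<exists>A :: real. \<forall>q \<ge> 2. D1 q \<le> A * sqrt (real q) * ln (real q)) \<and>
        (\<forall>q \<ge> 2. \<forall>d \<ge> 1. \<forall>N \<ge> 1. \<forall>f \<in> low_degree q N d.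
           (\<Sum>m\<in>low_indices q N d.
              cmod (fourier_coeff q N f m) powr (2 * real d / (real d + 1)))
             powr ((real d + 1) / (2 * real d))
           \<le> D1 q ^ d * sup_norm q N f)) \<and>
     (\<forall>q \<ge> 2. \<forall>d \<ge> 1. \<forall>p :: real. 0 < p \<and> p < 2 * real d / (real d + 1) \<longrightarrow>
        \<not> (\<exists>C :: real. \<forall>N \<ge> 1. \<forall>f \<in> low_degree q N d.
              (\<Sum>m\<in>low_indices q N d. cmod (fourier_coeff q N f m) powr p) powr (1 / p)
              \<le> C * sup_norm q N f))"
proof (intro conjI)
  \<comment> \<open>The constant obtained has no logarithm; \<open>ln q \<ge> ln 2\<close> lets it
    pass under the required bound.\<close>
  have growth: "256 * sqrt (real q) \<le> 256 / ln 2 * sqrt (real q) * ln (real q)" if "q \<ge> 2" for q :: nat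
  proof -
    have "1 \<le> ln (real q) / ln 2"
      using that by simp
    then have "256 * sqrt (real q) * 1 \<le> 256 * sqrt (real q) * (ln (real q) / ln 2)"
      by (intro mult_left_mono) auto
    then show ?thesis by simp
  qed
  have bound: "(\<Sum>m\<in>low_indices q N d. cmod (fourier_coeff q N f m) powr (2 * real d / (real d + 1)))
      powr ((real d + 1) / (2 * real d)) \<le> (256 * sqrt (real q)) ^ d * sup_norm q N f"
    if q: "q \<ge> 2" and d: "d \<ge> 1" and f: "f \<in> low_degree q N d" for q d N f
  proof -
    obtain a where a: "deg_le q N d a" "\<And>x. x \<in> cyc_cube q N \<Longrightarrow> f x = char_sum q N a x"
      using f low_degree_iff by blast
    have coeff: "fourier_coeff q N f m = a m" if "m \<in> low_indices q N d" for m
      using fourier_coeff_char_sum[OF _ a(2)] q that low_indices_subset by fastforce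
    have sup: "cmod (char_sum q N a x) \<le> sup_norm q N f" if "x \<in> cyc_cube q N" for x
      using norm_le_sup_norm[OF that, of f] a(2)[OF that] by simp
    obtain x where "x \<in> cyc_cube q N"
      using cyc_cube_nonempty[of q N] q by auto
    then have "0 \<le> sup_norm q N f"
      using sup norm_ge_zero order.trans by blast
    \<comment> \<open>\<open>bohnenblust_hille\<close> normalizes by a positive bound; a function of
      norm zero has no nonzero coefficient.\<close>
    then consider "sup_norm q N f = 0" | "sup_norm q N f > 0" by linarith
    then show ?thesis
    proof cases
      case 1
      then have "a m = 0" if "m \<in> low_indices q N d" for m
        using norm_coeff_le[of q N a 0 m] sup q subsetD[OF low_indices_subset that] by simp
      then show ?thesis using 1 coeff by simp
    next
      case 2
      obtain k where k: "d = Suc k" using d by (cases d) auto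
      have "(\<Sum>m\<in>low_indices q N d. cmod (fourier_coeff q N f m) powr (2 * real d / (real d + 1))) =
          (\<Sum>m\<in>multi_indices q N. cmod (a m) powr (2 * real d / (real d + 1)))"
        using coeff a(1) low_indices_subset
        by (intro sum.mono_neutral_cong_left) (auto simp: deg_le_def low_indices_def)
      then show ?thesis
        using bohnenblust_hille[of q N k a "sup_norm q N f" d] q a(1) 2 sup k by simp
    qed
  qed
  show "\<exists>D1 :: nat \<Rightarrow> real.
      (\<exists>A :: real. \<forall>q \<ge> 2. D1 q \<le> A * sqrt (real q) * ln (real q)) \<and>
      (\<forall>q \<ge> 2. \<forall>d \<ge> 1. \<forall>N \<ge> 1. \<forall>f \<in> low_degree q N d.
         (\<Sum>m\<in>low_indices q N d.
            cmod (fourier_coeff q N f m) powr (2 * real d / (real d + 1)))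
           powr ((real d + 1) / (2 * real d))
         \<le> D1 q ^ d * sup_norm q N f)"
    using growth bound by (intro exI[of _ "\<lambda>q. 256 * sqrt (real q)"] conjI exI[of _ "256 / ln 2"]) blast+
  show "\<forall>q \<ge> 2. \<forall>d \<ge> 1. \<forall>p :: real. 0 < p \<and> p < 2 * real d / (real d + 1) \<longrightarrow>
      \<not> (\<exists>C :: real. \<forall>N \<ge> 1. \<forall>f \<in> low_degree q N d.
            (\<Sum>m\<in>low_indices q N d. cmod (fourier_coeff q N f m) powr p) powr (1 / p)
            \<le> C * sup_norm q N f)"
    using exponent_optimal by blast
qed

end
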